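(* Let $H$ be a separable real Hilbert space with inner product $\langle\cdot,\cdot\rangle$ and norm $\|\cdot\|$, let $X$ be an $H$-valued random variable, and let $X_1,X_2,\ldots$ be i.i.d. copies of $X$. Assume that (i) for every $h\in H$ there exists $h'\in H$ with $\langle h,h'\rangle=0$ and $\mathrm{Var}(\langle h',X\rangle)>0$; (ii) there is a constant $C>0$ such that $\mathbb{E}[\|X-h\|^{-1}]\le C$ and $\mathbb{E}[\|X-h\|^{-2}]\le C$ for all $h\in H$. Let $m$ be the geometric median of $X$. Let $\alpha\in(1/2,1)$, $c_\gamma>0$, $\gamma_n=c_\gamma n^{-\alpha}$ for $n\ge 1$, let $Z_1$ be a bounded $\sigma(X_1)$-measurable $H$-valued random variable, and for $n\ge1$ let $$Z_{n+1}=Z_n+\gamma_n\frac{X_{n+1}-Z_n}{\|X_{n+1}-Z_n\|}.$$ Then, for every $\beta$ with $\alpha<\beta<3\alpha-1$, as $n\to\infty$, $$\mathbb{E}\left[\|Z_n-m\|^2\right]=O\left(\frac1{n^{\alpha}}\right),\qquad \mathbb{E}\left[\|Z_n-m\|^4\right]=O\left(\frac1{n^{\beta}}\right).$$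
   Context: The geometric median of $X$ is $m:=\arg\min_{h\in H}\mathbb{E}[\|X-h\|-\|X\|]$; under (i) it is uniquely defined. Condition (ii) implies $\mathbb{P}(X=h)=0$ for every $h\in H$, so the recursion is almost surely well defined. *)

theory Defs
  imports "HOL-Probability.Probability" "HOL-Library.Landau_Symbols"
begin

text \<open>
  No moment of \<open>Y\<close> is presupposed, so the variance takes values in \<open>[0, \<infinity>]\<close>. If \<open>Y\<close> is not
  integrable, its Bochner integral is \<open>0\<close> and the value below is \<open>\<infinity>\<close>, since on a probability
  space a non-integrable variable has infinite second moment.
\<close>

definition evariance :: "'a measure \<Rightarrow> ('a \<Rightarrow> real) \<Rightarrow> ennreal"
  where "evariance M Y = (\<integral>\<^sup>+\<omega>. ennreal ((Y \<omega> - (\<integral>\<omega>'. Y \<omega>' \<partial>M))\<^sup>2) \<partial>M)"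

text \<open>
  The integrand is bounded by \<open>norm h\<close>, so the Bochner integral is the genuine expectation
  even when \<open>X\<close> has no first moment.
\<close>

definition median_objective :: "'a measure \<Rightarrow> ('a \<Rightarrow> 'h::real_normed_vector) \<Rightarrow> 'h \<Rightarrow> real"
  where "median_objective M X h = (\<integral>\<omega>. norm (X \<omega> - h) - norm (X \<omega>) \<partial>M)"

definition is_geometric_median :: "'a measure \<Rightarrow> ('a \<Rightarrow> 'h::real_normed_vector) \<Rightarrow> 'h \<Rightarrow> bool"
  where "is_geometric_median M X m \<longleftrightarrow> is_arg_min (median_objective M X) (\<lambda>_. True) m"

text \<open>
  In \<^typ>\<open>ennreal\<close> the inverse of \<open>0\<close> is \<open>\<infinity>\<close> (over the reals it would be \<open>0\<close>), so finiteness
  for some \<open>p > 0\<close> forces \<open>X \<noteq> h\<close> almost surely.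
\<close>

definition inverse_moment :: "nat \<Rightarrow> 'a measure \<Rightarrow> ('a \<Rightarrow> 'h::real_normed_vector) \<Rightarrow> 'h \<Rightarrow> ennreal"
  where "inverse_moment p M X h = (\<integral>\<^sup>+\<omega>. inverse (ennreal (norm (X \<omega> - h))) ^ p \<partial>M)"

end

theory Submission
  imports Defs "HOL-Real_Asymp.Real_Asymp"
begin

text \<open>
Write \<open>r\<^sub>n\<close> for the distance of \<open>Z n\<close> to the median \<open>m\<close> and \<open>s p n\<close> for the expectation of
\<open>r\<^sub>n ^ (2 * p)\<close>. The proof is a Lyapunov argument run simultaneously on all even moments. It gives the rate \<open>n powr - (p * \<alpha>)\<close> for every \<open>s p\<close>; the exponent \<open>2 * \<alpha>\<close> for \<open>p = 2\<close> exceeds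
every \<open>\<beta> < 3 * \<alpha> - 1\<close>.

\<^bold>\<open>Drift.\<close> The increment of the algorithm is a multiple of \<open>sgn (X - h)\<close>, and \<open>h \<mapsto> - sgn (X - h)\<close> is
a monotone field whose gain is governed by the distance of \<open>X - m\<close> to the line through \<open>m\<close> and
\<open>h\<close> (lemma \<open>sgn_strongly_mono\<close>). Hypothesis (i) says that \<open>X\<close> is not concentrated on any line
through \<open>m\<close>, so the support of \<open>X - m\<close> contains two linearly independent points, and every line
through the origin misses at least one of them by a fixed amount. Together with optimality of
\<open>m\<close> this yields, for all \<open>h\<close> at once, a mean pull towards \<open>m\<close> of order \<open>r\<^sup>2 / (1 + r)\<close>, where
\<open>r\<close> is the distance from \<open>h\<close> to \<open>m\<close> (lemma \<open>drift_towards_median\<close>).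

\<^bold>\<open>Moment recursion.\<close> Expanding \<open>r ^ (2 * p)\<close> to second order and averaging over the new sample,
which is independent of the current iterate, gives
\<open>s p (n + 1) \<le> s p n - 2 p \<kappa> \<gamma>\<^sub>n E[r\<^sub>n ^ (2 p) / (1 + r\<^sub>n)] + O(\<gamma>\<^sub>n\<^sup>2) (s (p - 1) n + \<gamma>\<^sub>n ^ (2 p - 2))\<close>.

\<^bold>\<open>Rates.\<close> The denominator \<open>1 + r\<^sub>n\<close> is the only obstacle to a contraction, because the gradient is
bounded and the objective is not strongly convex at infinity. It is removed by bootstrapping.
Since \<open>\<gamma>\<^sub>n\<^sup>2\<close> is summable, induction on \<open>p\<close> bounds all moments. Truncating at
\<open>r\<^sub>n \<le> n powr \<epsilon>\<close> then costs only an arbitrarily high negative power of \<open>n\<close>, while the contraction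
factor \<open>1 - const * n powr - (\<alpha> + \<epsilon>)\<close> still beats \<open>1 - const / n\<close>; this shows that \<open>s p\<close> decays
at a rate growing linearly in \<open>p\<close>. So truncating even at \<open>r\<^sub>n \<le> 1\<close> is harmless, and a last pass
with \<open>\<epsilon> = 0\<close> gives the sharp rate.
\<close>

section \<open>Strong monotonicity of the unit direction field\<close>

text \<open>
The unit direction \<open>sgn\<close> is a subgradient of the norm, at the origin as well thanks to the value
\<open>sgn 0 = 0\<close>, hence monotone.
\<close>

lemma sgn_mono:
  fixes y w :: "'h::real_inner"
  shows "0 \<le> inner (sgn y - sgn w) (y - w)"
proof -
  have "inner (sgn y) w \<le> norm w" "inner (sgn w) y \<le> norm y"
    using norm_cauchy_schwarz[of "sgn y" w] norm_cauchy_schwarz[of "sgn w" y]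
    by (auto simp: norm_sgn split: if_splits)
  moreover have "inner (sgn y) y = norm y" "inner (sgn w) w = norm w"
    by (cases "y = 0"; cases "w = 0"; simp add: sgn_div_norm dot_square_norm power2_eq_square)+
  ultimately show ?thesis by (simp add: inner_diff_left inner_diff_right)
qed

text \<open>
For unit vectors \<open>a\<close>, \<open>b\<close> in the directions of \<open>y\<close>, \<open>w\<close>, the inner product of \<open>a - b\<close> and
\<open>y - w\<close> is \<open>(norm y + norm w) * (1 - inner a b)\<close>, and \<open>1 - inner a b\<close> is at least half of the
squared sine of the angle between \<open>y\<close> and \<open>w\<close>. The left-hand side is the squared area of the
parallelogram spanned by \<open>y\<close> and \<open>y - w\<close>, equivalently by \<open>y\<close> and \<open>w\<close>.
\<close>

lemma sgn_strongly_mono: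
  fixes y w :: "'h::real_inner"
  shows "(norm y)\<^sup>2 * (norm (y - w))\<^sup>2 - (inner y (y - w))\<^sup>2
    \<le> 2 * (norm y)\<^sup>2 * norm w * inner (sgn y - sgn w) (y - w)"
proof (cases "y = 0 \<or> w = 0")
  case True
  then show ?thesis
    by (auto simp: dot_square_norm power2_eq_square)
next
  case False
  define a b i where "a = norm y" and "b = norm w" and "i = inner y w"
  have ab: "a > 0" "b > 0" using False by (auto simp: a_def b_def)
  have i: "\<bar>i\<bar> \<le> a * b" using Cauchy_Schwarz_ineq2[of y w] by (simp add: a_def b_def i_def)
  have n: "(norm (y - w))\<^sup>2 = a\<^sup>2 - 2 * i + b\<^sup>2"
    by (simp add: a_def b_def i_def power2_norm_eq_inner inner_diff_left inner_diff_right inner_commute)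
  have yw: "inner y (y - w) = a\<^sup>2 - i"
    by (simp add: a_def i_def power2_norm_eq_inner inner_diff_right)
  have "inner (sgn y - sgn w) (y - w) = a - i / a - i / b + b"
    using ab by (simp add: sgn_div_norm inner_diff_left inner_diff_right a_def b_def i_def
        inner_commute dot_square_norm power2_eq_square field_simps)
  also have "\<dots> = (a + b) * (a * b - i) / (a * b)"
    using ab by (simp add: field_simps)
  finally have s: "2 * a\<^sup>2 * b * inner (sgn y - sgn w) (y - w) = 2 * a * (a + b) * (a * b - i)"
    using ab by (simp add: power2_eq_square)
  have "a\<^sup>2 * (a\<^sup>2 - 2 * i + b\<^sup>2) - (a\<^sup>2 - i)\<^sup>2 = (a * b + i) * (a * b - i)"
    by (simp add: power2_eq_square algebra_simps)
  also have "\<dots> \<le> (2 * a * (a + b)) * (a * b - i)"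
  proof (rule mult_right_mono)
    have "a * a > 0" using ab by simp
    then show "a * b + i \<le> 2 * a * (a + b)" using i by (simp add: algebra_simps)
  qed (use i in simp)
  finally show ?thesis using s n yw by (simp add: a_def b_def)
qed

lemma norm_orthogonal_part:
  fixes e z :: "'h::real_inner"
  assumes "norm e = 1"
  shows "(norm (z - inner e z *\<^sub>R e))\<^sup>2 = (norm z)\<^sup>2 - (inner e z)\<^sup>2"
proof -
  have "inner e e = 1" using assms by (simp add: dot_square_norm)
  then show ?thesis
    by (simp add: power2_norm_eq_inner inner_diff_left inner_diff_right inner_commute)
      (simp add: power2_eq_square)
qed

lemma norm_orthogonal_part_le:
  fixes e z :: "'h::real_inner"
  assumes "norm e = 1"
  shows "norm (z - inner e z *\<^sub>R e) \<le> norm z"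
  by (rule power2_le_imp_le) (simp_all add: norm_orthogonal_part[OF assms])

text \<open>
If a line were close to both \<open>x1\<close> and \<open>x2\<close>, it would be close to \<open>x1\<close> and to the component \<open>u\<close> of
\<open>x2\<close> orthogonal to \<open>x1\<close>; by Bessel's inequality the squared cosines of its angles with these two
orthogonal vectors sum to at most \<open>1\<close>, so it cannot be nearly parallel to both.
\<close>

lemma uniformly_far_from_lines:
  fixes x1 x2 :: "'h::real_inner"
  assumes "x1 \<noteq> 0" and "\<And>k. x2 \<noteq> k *\<^sub>R x1"
  shows "\<exists>\<delta>>0. \<forall>e. norm e = 1 \<longrightarrow> (\<exists>x\<in>{x1, x2}. \<delta> \<le> norm (x - inner e x *\<^sub>R e))"
proof -
  define k where "k = inner x1 x2 / inner x1 x1"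
  define u where "u = x2 - k *\<^sub>R x1"
  have u0: "u \<noteq> 0" using assms(2)[of k] by (simp add: u_def)
  have orth: "inner x1 u = 0"
    using assms(1) by (simp add: u_def k_def inner_diff_right)
  define S where "S = 1 / (norm x1)\<^sup>2 + (1 + \<bar>k\<bar>)\<^sup>2 / (norm u)\<^sup>2"
  have S: "S > 0" using assms(1) u0 by (auto simp: S_def intro!: add_pos_nonneg)
  define \<delta> where "\<delta> = 1 / sqrt S"
  have \<delta>: "\<delta> > 0" "\<delta>\<^sup>2 * S = 1" using S by (auto simp: \<delta>_def power_divide)
  have "\<exists>x\<in>{x1, x2}. \<delta> \<le> norm (x - inner e x *\<^sub>R e)" if e: "norm e = 1" for e
  proof (rule ccontr)
    define P where "P = (\<lambda>x. x - inner e x *\<^sub>R e)"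
    assume "\<not> ?thesis"
    then have d: "norm (P x1) < \<delta>" "norm (P x2) < \<delta>" by (auto simp: P_def)
    have "P u = P x2 - k *\<^sub>R P x1"
      by (simp add: P_def u_def inner_diff_right algebra_simps)
    then have "norm (P u) \<le> norm (P x2) + \<bar>k\<bar> * norm (P x1)"
      using norm_triangle_ineq4[of "P x2" "k *\<^sub>R P x1"] by simp
    also have "\<dots> \<le> \<delta> + \<bar>k\<bar> * \<delta>"
      using d by (intro add_mono mult_left_mono) auto
    finally have Pu: "norm (P u) \<le> (1 + \<bar>k\<bar>) * \<delta>" by (simp add: algebra_simps)
    have ee: "inner e e = 1" using e by (simp add: dot_square_norm)
    have P2: "(norm (P x))\<^sup>2 = (norm x)\<^sup>2 - (inner e x)\<^sup>2" for x
      unfolding P_def by (rule norm_orthogonal_part[OF e])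
    \<comment> \<open>Bessel's inequality for the orthogonal pair \<open>x1\<close>, \<open>u\<close>.\<close>
    have "0 \<le> (norm (e - (inner e x1 / (norm x1)\<^sup>2) *\<^sub>R x1 - (inner e u / (norm u)\<^sup>2) *\<^sub>R u))\<^sup>2"
      by simp
    also have "\<dots> = 1 - (inner e x1)\<^sup>2 / (norm x1)\<^sup>2 - (inner e u)\<^sup>2 / (norm u)\<^sup>2"
      using assms(1) u0 orth
      by (simp add: power2_norm_eq_inner inner_diff_left inner_diff_right ee inner_commute)
        (simp add: power2_eq_square field_simps)
    finally have bessel: "(inner e x1)\<^sup>2 / (norm x1)\<^sup>2 + (inner e u)\<^sup>2 / (norm u)\<^sup>2 \<le> 1" by simp
    have "2 - ((inner e x1)\<^sup>2 / (norm x1)\<^sup>2 + (inner e u)\<^sup>2 / (norm u)\<^sup>2)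
        = (norm (P x1))\<^sup>2 / (norm x1)\<^sup>2 + (norm (P u))\<^sup>2 / (norm u)\<^sup>2"
      using assms(1) u0 by (simp add: P2 field_simps)
    with bessel have "1 \<le> (norm (P x1))\<^sup>2 / (norm x1)\<^sup>2 + (norm (P u))\<^sup>2 / (norm u)\<^sup>2" by simp
    also have "\<dots> < \<delta>\<^sup>2 / (norm x1)\<^sup>2 + ((1 + \<bar>k\<bar>) * \<delta>)\<^sup>2 / (norm u)\<^sup>2"
      using assms(1) u0 d Pu \<delta>
      by (intro add_less_le_mono divide_strict_right_mono divide_right_mono power_mono power_strict_mono) auto
    also have "\<dots> = \<delta>\<^sup>2 * S" unfolding S_def power_mult_distrib by (simp add: field_simps)
    finally show False using \<delta> by simp
  qed
  with \<delta> show ?thesis by blast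
qed

text \<open>
Quantitative form of strong monotonicity between the two points \<open>(t * r) *\<^sub>R e\<close> and \<open>r *\<^sub>R e\<close> of a
ray, seen from a point \<open>p\<close> near \<open>x\<close>, when \<open>x\<close> lies off the line through \<open>e\<close>. The condition
\<open>t * r \<le> 1\<close> keeps the first point within a fixed ball, which is what makes the bound grow
linearly in \<open>r\<close> for large \<open>r\<close>; this argument gives less for two points both at distance of order
\<open>r\<close>.
\<close>

lemma sgn_gap_lower_bound:
  fixes e p x :: "'h::real_inner" and r t K \<delta> :: real
  assumes e: "norm e = 1" and r: "0 < r" and t: "t \<le> 1 / 2" "0 < t" "t * r \<le> 1"
    and \<delta>: "0 < \<delta>" "\<delta> \<le> norm (x - inner e x *\<^sub>R e)" and near: "norm (x - p) < \<delta> / 2"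
    and K: "norm x + \<delta> / 2 + 1 \<le> K"
  shows "\<delta>\<^sup>2 / (32 * K ^ 3) * (r\<^sup>2 / (1 + r))
    \<le> inner (sgn (p - (t * r) *\<^sub>R e) - sgn (p - r *\<^sub>R e)) (((1 - t) * r) *\<^sub>R e)"
proof -
  define y w d where "y = p - (t * r) *\<^sub>R e" and "w = p - r *\<^sub>R e" and "d = ((1 - t) * r) *\<^sub>R e"
  define I where "I = inner (sgn y - sgn w) d"
  define P where "P = (\<lambda>z. z - inner e z *\<^sub>R e)"
  have ee: "inner e e = 1" using e by (simp add: dot_square_norm)
  have K0: "K \<ge> 1" "K > 0" using K \<delta>(1) norm_ge_zero[of x] by linarith+
  have yw: "y - w = d" by (simp add: y_def w_def d_def algebra_simps)
  have I0: "0 \<le> I" using sgn_mono[of y w] unfolding yw I_def .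
  have Pxy: "P x - P y = P (x - p)"
    by (simp add: P_def y_def inner_diff_right ee algebra_simps)
  have "norm (P (x - p)) \<le> norm (x - p)"
    unfolding P_def by (rule norm_orthogonal_part_le[OF e])
  with near Pxy have "norm (P x - P y) < \<delta> / 2" by simp
  then have Py: "\<delta> / 2 \<le> norm (P y)"
    using \<delta>(2) norm_triangle_ineq2[of "P x" "P y"] unfolding P_def by linarith
  have pK: "norm p \<le> K - 1"
    using near norm_triangle_ineq2[of p x] K by (simp add: norm_minus_commute)
  have "norm y \<le> norm p + t * r"
    using norm_triangle_ineq4[of p "(t * r) *\<^sub>R e"] t(2) r e unfolding y_def by simp
  then have yK: "norm y \<le> K" using pK t(3) by linarith
  have "norm w \<le> norm p + r"
    using norm_triangle_ineq4[of p "r *\<^sub>R e"] r e unfolding w_def by simp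
  also have "\<dots> \<le> K + K * r" using pK K0(1) r mult_right_mono[of 1 K r] by linarith
  finally have wK: "norm w \<le> K * (1 + r)" by (simp add: distrib_left)
  have r2: "r / 2 \<le> (1 - t) * r" using mult_right_mono[OF t(1), of r] r unfolding left_diff_distrib by linarith
  have "(r / 2)\<^sup>2 * (\<delta> / 2)\<^sup>2 \<le> ((1 - t) * r)\<^sup>2 * (norm (P y))\<^sup>2"
    using Py r2 r \<delta>(1) by (intro mult_mono power_mono) auto
  also have "\<dots> = (norm y)\<^sup>2 * (norm d)\<^sup>2 - (inner y d)\<^sup>2"
    unfolding P_def norm_orthogonal_part[OF e] d_def inner_scaleR_right norm_scaleR e
      inner_commute[of y e] power_mult_distrib power2_abs
    by (simp add: algebra_simps)
  also have "\<dots> \<le> 2 * (norm y)\<^sup>2 * norm w * I"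
    using sgn_strongly_mono[of y w] unfolding yw I_def .
  also have "\<dots> \<le> 2 * K\<^sup>2 * (K * (1 + r)) * I"
    using yK wK I0 K0 r by (intro mult_right_mono mult_mono power_mono) auto
  finally have *: "r\<^sup>2 * \<delta>\<^sup>2 / 16 \<le> 2 * K ^ 3 * (1 + r) * I"
    by (simp add: power_divide power2_eq_square power3_eq_cube mult_ac)
  have "\<delta>\<^sup>2 / (32 * K ^ 3) * (r\<^sup>2 / (1 + r)) = (r\<^sup>2 * \<delta>\<^sup>2 / 16) / (2 * K ^ 3 * (1 + r))"
    by (simp add: mult_ac)
  also have "\<dots> \<le> I"
    using * K0 r by (subst pos_divide_le_eq) (auto simp: mult_ac)
  finally show ?thesis by (simp add: I_def y_def w_def d_def)
qed

section \<open>Drift towards the median\<close>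

lemma borel_measurable_sgn_real_inner [measurable (raw)]:
  fixes f :: "'a \<Rightarrow> 'h::{real_inner, second_countable_topology}"
  assumes [measurable]: "f \<in> borel_measurable M"
  shows "(\<lambda>\<omega>. sgn (f \<omega>)) \<in> borel_measurable M"
  unfolding sgn_div_norm by measurable

lemma abs_inner_sgn_le: "\<bar>inner (sgn x) v\<bar> \<le> norm (v::'h::real_inner)"
  using Cauchy_Schwarz_ineq2[of "sgn x" v] by (auto simp: norm_sgn split: if_splits)

text \<open>
The open null sets have a countable subfamily with the same union, so their union is null.
\<close>

lemma AE_support:
  fixes N :: "'h::{metric_space, second_countable_topology} measure"
  assumes "sets N = sets borel"
  shows "AE x in N. \<forall>\<rho>>0. emeasure N (ball x \<rho>) > 0"
proof -
  define F where "F = {U. open U \<and> emeasure N U = 0}"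
  obtain F' where F': "F' \<subseteq> F" "countable F'" "\<Union>F' = \<Union>F"
    by (rule Lindelof[of F]) (auto simp: F_def)
  have "(\<Union>U\<in>F'. U) \<in> null_sets N"
    using F' assms by (intro null_sets_UN') (auto simp: F_def null_sets_def)
  then have "\<Union>F \<in> null_sets N" using F' by simp
  then show ?thesis
  proof (rule AE_I'[OF _ subsetI])
    fix x assume "x \<in> {x \<in> space N. \<not> (\<forall>\<rho>>0. emeasure N (ball x \<rho>) > 0)}"
    then obtain \<rho> where "\<rho> > 0" "emeasure N (ball x \<rho>) = 0" by (auto simp: zero_less_iff_neq_zero)
    then have "x \<in> ball x \<rho>" "ball x \<rho> \<in> F" by (auto simp: F_def)
    then show "x \<in> \<Union>F" by blast
  qed
qed

context prob_space
begin

lemma integrable_inner_sgn: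
  fixes X :: "'a \<Rightarrow> 'h::{real_inner, complete_space, second_countable_topology}"
  assumes [measurable]: "X \<in> borel_measurable M"
  shows "integrable M (\<lambda>\<omega>. inner (sgn (X \<omega> - h)) v)"
  by (rule integrable_const_bound[of _ "norm v"]) (auto simp: abs_inner_sgn_le)

text \<open>
Convexity of the norm turns optimality of \<open>m\<close> into a sign for the directional derivative at any
point \<open>m + t *\<^sub>R v\<close> beyond \<open>m\<close>. Using \<open>t > 0\<close> instead of \<open>t = 0\<close> avoids passing to the limit under
the expectation.
\<close>

lemma median_subgradient:
  fixes X :: "'a \<Rightarrow> 'h::{real_inner, complete_space, second_countable_topology}"
  assumes X [measurable]: "X \<in> borel_measurable M"
    and median: "is_geometric_median M X m" and t: "0 < t"
  shows "expectation (\<lambda>\<omega>. inner (sgn (X \<omega> - (m + t *\<^sub>R v))) v) \<le> 0"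
proof -
  define h where "h = m + t *\<^sub>R v"
  have int: "integrable M (\<lambda>\<omega>. norm (X \<omega> - h') - norm (X \<omega>))" for h'
    by (rule integrable_const_bound[of _ "norm h'"])
      (auto intro!: AE_I2 norm_triangle_ineq3[THEN order.trans])
  have "median_objective M X m \<le> median_objective M X h"
    using median by (auto simp: is_geometric_median_def is_arg_min_def not_less)
  then have "0 \<le> expectation (\<lambda>\<omega>. norm (X \<omega> - h) - norm (X \<omega> - m))"
    using Bochner_Integration.integral_diff[OF int[of h] int[of m]] by (simp add: median_objective_def)
  also have "\<dots> \<le> expectation (\<lambda>\<omega>. - t * inner (sgn (X \<omega> - h)) v)"
  proof (rule integral_mono)
    fix \<omega>
    have "norm (X \<omega> - h) + t * inner (sgn (X \<omega> - h)) v = inner (sgn (X \<omega> - h)) (X \<omega> - m)"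
    proof -
      have "inner (sgn (X \<omega> - h)) (X \<omega> - h) = norm (X \<omega> - h)"
        by (cases "X \<omega> = h") (simp_all add: sgn_div_norm dot_square_norm power2_eq_square)
      moreover have "X \<omega> - m = (X \<omega> - h) + t *\<^sub>R v" by (simp add: h_def)
      ultimately show ?thesis by (simp only: inner_add_right inner_scaleR_right)
    qed
    also have "\<dots> \<le> norm (X \<omega> - m)" using abs_inner_sgn_le abs_le_D1 by blast
    finally show "norm (X \<omega> - h) - norm (X \<omega> - m) \<le> - t * inner (sgn (X \<omega> - h)) v" by simp
  qed (use Bochner_Integration.integrable_diff[OF int[of h] int[of m]] integrable_inner_sgn[OF X] in auto)
  also have "\<dots> = - t * expectation (\<lambda>\<omega>. inner (sgn (X \<omega> - h)) v)" by simp
  finally show ?thesis using t by (simp add: h_def mult_le_0_iff zero_le_mult_iff)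
qed

lemma evariance_const_eq_0:
  assumes "AE \<omega> in M. Y \<omega> = k" and [measurable]: "Y \<in> borel_measurable M"
  shows "evariance M Y = 0"
proof -
  have "expectation Y = expectation (\<lambda>_. k)" using assms by (intro integral_cong_AE) auto
  then have "expectation Y = k" by (simp add: prob_space)
  then have "evariance M Y = (\<integral>\<^sup>+\<omega>. 0 \<partial>M)"
    unfolding evariance_def using assms(1) by (intro nn_integral_cong_AE) auto
  then show ?thesis by simp
qed

text \<open>
On a line with direction \<open>e\<close>, every \<open>h'\<close> orthogonal to \<open>e\<close> has a constant inner product with
\<open>X\<close>, hence zero variance.
\<close>

lemma not_AE_on_line:
  fixes X :: "'a \<Rightarrow> 'h::{real_inner, complete_space, second_countable_topology}"
  assumes [measurable]: "X \<in> borel_measurable M"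
    and "\<exists>h'. inner e h' = 0 \<and> evariance M (\<lambda>\<omega>. inner h' (X \<omega>)) > 0"
  shows "\<not> (AE \<omega> in M. \<exists>k. X \<omega> - m = k *\<^sub>R e)"
proof
  assume *: "AE \<omega> in M. \<exists>k. X \<omega> - m = k *\<^sub>R e"
  obtain h where h: "inner e h = 0" "evariance M (\<lambda>\<omega>. inner h (X \<omega>)) > 0" using assms(2) by blast
  have "AE \<omega> in M. inner h (X \<omega>) = inner h m"
    using *
  proof eventually_elim
    case (elim \<omega>)
    then obtain k where "X \<omega> = m + k *\<^sub>R e" by (auto simp: algebra_simps)
    then show ?case using h(1) by (simp add: inner_add_right inner_commute)
  qed
  from evariance_const_eq_0[OF this] h(2) show False by simp
qed

text \<open>
Almost every value of \<open>X - m\<close> is in the support. As \<open>X - m\<close> does not almost surely vanish, some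
support point \<open>x1\<close> is nonzero; as \<open>X - m\<close> does not almost surely lie on the line of \<open>x1\<close>, some
support point \<open>x2\<close> lies off that line.
\<close>

lemma noncollinear_support_points:
  fixes X :: "'a \<Rightarrow> 'h::{real_inner, complete_space, second_countable_topology}"
  assumes X [measurable]: "X \<in> borel_measurable M"
    and cond: "\<And>h. \<exists>h'. inner h h' = 0 \<and> evariance M (\<lambda>\<omega>. inner h' (X \<omega>)) > 0"
  obtains x1 x2 where "x1 \<noteq> 0" "\<And>k. x2 \<noteq> k *\<^sub>R x1"
    "\<And>x \<rho>. x \<in> {x1, x2} \<Longrightarrow> \<rho> > 0 \<Longrightarrow> prob {\<omega> \<in> space M. X \<omega> - m \<in> ball x \<rho>} > 0"
proof -
  define supp where "supp x \<longleftrightarrow> (\<forall>\<rho>>0. prob {\<omega> \<in> space M. X \<omega> - m \<in> ball x \<rho>} > 0)" for x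
  have "AE x in distr M borel (\<lambda>\<omega>. X \<omega> - m). \<forall>\<rho>>0. emeasure (distr M borel (\<lambda>\<omega>. X \<omega> - m)) (ball x \<rho>) > 0"
    by (rule AE_support) simp
  then have "AE \<omega> in M. \<forall>\<rho>>0. emeasure (distr M borel (\<lambda>\<omega>. X \<omega> - m)) (ball (X \<omega> - m) \<rho>) > 0"
    by (rule AE_distrD[rotated]) measurable
  then have supp: "AE \<omega> in M. supp (X \<omega> - m)"
    by eventually_elim
      (auto simp: supp_def emeasure_distr emeasure_eq_measure vimage_def Int_def conj_commute
        simp del: mem_ball)
  have "\<exists>\<omega>. supp (X \<omega> - m) \<and> \<not> (\<exists>k. X \<omega> - m = k *\<^sub>R e)" for e
  proof (rule ccontr)
    assume *: "\<not> ?thesis"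
    from supp have "AE \<omega> in M. \<exists>k. X \<omega> - m = k *\<^sub>R e" by eventually_elim (use * in blast)
    then show False using not_AE_on_line[OF X cond] by blast
  qed
  note ex = this
  obtain \<omega>1 where 1: "supp (X \<omega>1 - m)" "X \<omega>1 - m \<noteq> 0" using ex[of 0] by auto
  obtain \<omega>2 where 2: "supp (X \<omega>2 - m)" "\<And>k. X \<omega>2 - m \<noteq> k *\<^sub>R (X \<omega>1 - m)"
    using ex[of "X \<omega>1 - m"] by blast
  show thesis by (rule that[of "X \<omega>1 - m" "X \<omega>2 - m"]) (use 1 2 in \<open>auto simp: supp_def simp del: mem_ball\<close>)
qed

text \<open>
Compare the mean direction at \<open>h\<close> with the one at an auxiliary point \<open>h0\<close> on the segment from
\<open>m\<close> to \<open>h\<close>: the latter has the right sign by optimality, and the difference is bounded below on the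
event that \<open>X - m\<close> is near that one of the two noncollinear support points which is far from the
line through \<open>m\<close> and \<open>h\<close>. Both the probability of that event and the distance are bounded below
independently of \<open>h\<close>. As the mean direction is bounded, the pull cannot grow faster than linearly
in \<open>r\<close>, whence the denominator \<open>1 + r\<close>.
\<close>

lemma drift_towards_median:
  fixes X :: "'a \<Rightarrow> 'h::{real_inner, complete_space, second_countable_topology}"
  assumes X [measurable]: "X \<in> borel_measurable M"
    and cond: "\<And>h. \<exists>h'. inner h h' = 0 \<and> evariance M (\<lambda>\<omega>. inner h' (X \<omega>)) > 0"
    and median: "is_geometric_median M X m"
  shows "\<exists>\<kappa>>0. \<forall>h. expectation (\<lambda>\<omega>. inner (sgn (X \<omega> - h)) (h - m))
    \<le> - \<kappa> * ((norm (h - m))\<^sup>2 / (1 + norm (h - m)))"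
proof -
  obtain x1 x2 where x: "x1 \<noteq> 0" "\<And>k. x2 \<noteq> k *\<^sub>R x1"
    and supp: "\<And>x \<rho>. x \<in> {x1, x2} \<Longrightarrow> \<rho> > 0 \<Longrightarrow> prob {\<omega> \<in> space M. X \<omega> - m \<in> ball x \<rho>} > 0"
    by (rule noncollinear_support_points[OF X cond, where m = m]) (rule that)
  obtain \<delta> where \<delta>: "\<delta> > 0" "\<And>e. norm e = 1 \<Longrightarrow> \<exists>x\<in>{x1, x2}. \<delta> \<le> norm (x - inner e x *\<^sub>R e)"
    using uniformly_far_from_lines[OF x] by blast
  define S where "S = (\<lambda>x. {\<omega> \<in> space M. X \<omega> - m \<in> ball x (\<delta> / 2)})"
  have [measurable]: "S x \<in> events" for x unfolding S_def mem_ball dist_norm by measurable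
  define \<pi> where "\<pi> = min (prob (S x1)) (prob (S x2))"
  have \<pi>: "\<pi> > 0" using supp[of x1 "\<delta> / 2"] supp[of x2 "\<delta> / 2"] \<delta>(1) unfolding \<pi>_def S_def by simp
  define K where "K = norm x1 + norm x2 + \<delta> / 2 + 1"
  have K: "K \<ge> 1" using \<delta> by (simp add: K_def)
  define \<kappa>0 where "\<kappa>0 = \<delta>\<^sup>2 / (32 * K ^ 3)"
  have \<kappa>0: "\<kappa>0 > 0" using \<delta> K by (simp add: \<kappa>0_def)
  have "expectation (\<lambda>\<omega>. inner (sgn (X \<omega> - h)) (h - m))
    \<le> - (\<pi> * \<kappa>0) * ((norm (h - m))\<^sup>2 / (1 + norm (h - m)))" for h
  proof (cases "h = m")
    case True
    then show ?thesis by simp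
  next
    case False
    define v r where "v = h - m" and "r = norm v"
    have r: "r > 0" using False by (simp add: r_def v_def)
    define e where "e = v /\<^sub>R r"
    have e: "norm e = 1" "v = r *\<^sub>R e" using r by (simp_all add: e_def r_def)
    obtain x where x: "x \<in> {x1, x2}" "\<delta> \<le> norm (x - inner e x *\<^sub>R e)" using \<delta>(2)[OF e(1)] by blast
    \<comment> \<open>The base point \<open>m + t *\<^sub>R v\<close> stays within distance \<open>1\<close> of \<open>m\<close> while keeping
      at least half of the distance to \<open>h\<close>.\<close>
    define t where "t = 1 / (2 + r)"
    have t: "0 < t" "t \<le> 1 / 2" "t * r \<le> 1" using r by (auto simp: t_def field_simps)
    define h0 where "h0 = m + t *\<^sub>R v"
    define I where "I = (\<lambda>\<omega>. inner (sgn (X \<omega> - h0) - sgn (X \<omega> - h)) ((1 - t) *\<^sub>R v))"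
    have I_eq: "I \<omega> = inner (sgn ((X \<omega> - m) - (t * r) *\<^sub>R e) - sgn ((X \<omega> - m) - r *\<^sub>R e)) (((1 - t) * r) *\<^sub>R e)" for \<omega>
    proof -
      have "X \<omega> - h0 = (X \<omega> - m) - (t * r) *\<^sub>R e" by (simp add: h0_def e(2))
      moreover have "X \<omega> - h = (X \<omega> - m) - r *\<^sub>R e" by (simp add: v_def flip: e(2))
      moreover have "(1 - t) *\<^sub>R v = ((1 - t) * r) *\<^sub>R e" by (simp add: e(2))
      ultimately show ?thesis by (simp only: I_def)
    qed
    have I0: "0 \<le> I \<omega>" for \<omega>
      using sgn_mono[of "(X \<omega> - m) - (t * r) *\<^sub>R e" "(X \<omega> - m) - r *\<^sub>R e"]
      unfolding I_eq by (simp add: algebra_simps)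
    have "norm x + \<delta> / 2 + 1 \<le> K" using x(1) unfolding K_def by auto
    then have I1: "\<kappa>0 * (r\<^sup>2 / (1 + r)) \<le> I \<omega>" if "\<omega> \<in> S x" for \<omega>
      unfolding I_eq \<kappa>0_def using that e(1) r t \<delta>(1) x(2)
      by (intro sgn_gap_lower_bound[of e r t \<delta> x]) (auto simp: S_def dist_norm)
    have intI: "integrable M I"
      unfolding I_def inner_diff_left by (intro Bochner_Integration.integrable_diff integrable_inner_sgn X)
    have "\<pi> * (\<kappa>0 * (r\<^sup>2 / (1 + r))) \<le> prob (S x) * (\<kappa>0 * (r\<^sup>2 / (1 + r)))"
      using x(1) \<kappa>0 r by (intro mult_right_mono) (auto simp: \<pi>_def)
    also have "\<dots> = expectation (\<lambda>\<omega>. indicator (S x) \<omega> * (\<kappa>0 * (r\<^sup>2 / (1 + r))))"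
      by simp
    also have "\<dots> \<le> expectation I"
    proof (rule integral_mono[OF _ intI])
      show "integrable M (\<lambda>\<omega>. indicator (S x) \<omega> * (\<kappa>0 * (r\<^sup>2 / (1 + r))))"
        by (rule integrable_const_bound[of _ "\<bar>\<kappa>0 * (r\<^sup>2 / (1 + r))\<bar>"]) (auto split: split_indicator)
    qed (use I0 I1 in \<open>auto split: split_indicator\<close>)
    also have "\<dots> = (1 - t) * (expectation (\<lambda>\<omega>. inner (sgn (X \<omega> - h0)) v) - expectation (\<lambda>\<omega>. inner (sgn (X \<omega> - h)) v))"
      unfolding I_def inner_diff_left by (simp add: integrable_inner_sgn algebra_simps)
    also have "\<dots> \<le> (1 - t) * (- expectation (\<lambda>\<omega>. inner (sgn (X \<omega> - h)) v))"
      using median_subgradient[OF X median t(1), of v] t by (intro mult_left_mono) (auto simp: h0_def)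
    finally have main: "\<pi> * (\<kappa>0 * (r\<^sup>2 / (1 + r))) \<le> (1 - t) * (- expectation (\<lambda>\<omega>. inner (sgn (X \<omega> - h)) v))" .
    have "0 \<le> \<pi> * (\<kappa>0 * (r\<^sup>2 / (1 + r)))" using \<pi> \<kappa>0 r by simp
    also note main
    finally have nonneg: "0 \<le> - expectation (\<lambda>\<omega>. inner (sgn (X \<omega> - h)) v)"
      using t by (subst (asm) zero_le_mult_iff) auto
    have "(1 - t) * (- expectation (\<lambda>\<omega>. inner (sgn (X \<omega> - h)) v)) \<le> 1 * (- expectation (\<lambda>\<omega>. inner (sgn (X \<omega> - h)) v))"
      using t(1) by (intro mult_right_mono nonneg) simp
    then have "\<pi> * (\<kappa>0 * (r\<^sup>2 / (1 + r))) \<le> - expectation (\<lambda>\<omega>. inner (sgn (X \<omega> - h)) v)"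
      using main by linarith
    then show ?thesis unfolding v_def[symmetric] r_def[symmetric] by (simp only: mult.assoc minus_mult_left[symmetric])
  qed
  moreover have "\<pi> * \<kappa>0 > 0" using \<pi> \<kappa>0 by simp
  ultimately show ?thesis by blast
qed

end

section \<open>One-step expansion of the even moments\<close>

text \<open>
The remainder \<open>R\<close> of the first-order expansion satisfies
\<open>R (Suc k) = x * R k + Suc k * v ^ k * (x - v)\<^sup>2\<close>, which drives the induction. The factor \<open>b\<close> on the
left avoids the exponent \<open>k - 1\<close> on the right.
\<close>

lemma Taylor_power:
  fixes x v b :: real
  assumes "0 \<le> x" "x \<le> b" "0 \<le> v" "v \<le> b"
  shows "b * (x ^ Suc k - v ^ Suc k - Suc k * v ^ k * (x - v)) \<le> (Suc k)\<^sup>2 * b ^ k * (x - v)\<^sup>2"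
proof (induction k)
  case 0
  then show ?case by simp
next
  case (Suc k)
  define R where "R = x ^ Suc k - v ^ Suc k - Suc k * v ^ k * (x - v)"
  have b: "b \<ge> 0" using assms by simp
  have "b * (x ^ Suc (Suc k) - v ^ Suc (Suc k) - Suc (Suc k) * v ^ Suc k * (x - v))
    = x * (b * R) + Suc k * b * v ^ k * (x - v)\<^sup>2"
    by (simp add: R_def power2_eq_square algebra_simps)
  also have "x * (b * R) \<le> x * ((Suc k)\<^sup>2 * b ^ k * (x - v)\<^sup>2)"
    using Suc assms by (intro mult_left_mono) (auto simp: R_def)
  also have "\<dots> \<le> b * ((Suc k)\<^sup>2 * b ^ k * (x - v)\<^sup>2)"
    using assms b by (intro mult_right_mono) auto
  also have "Suc k * b * v ^ k * (x - v)\<^sup>2 \<le> Suc k * b * b ^ k * (x - v)\<^sup>2"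
    using assms b by (intro mult_right_mono mult_left_mono power_mono) auto
  also have "b * ((Suc k)\<^sup>2 * b ^ k * (x - v)\<^sup>2) + Suc k * b * b ^ k * (x - v)\<^sup>2
     = ((Suc k)\<^sup>2 + Suc k) * (b ^ Suc k * (x - v)\<^sup>2)"
    by (simp add: algebra_simps)
  also have "\<dots> \<le> (Suc (Suc k))\<^sup>2 * (b ^ Suc k * (x - v)\<^sup>2)"
    by (rule mult_right_mono) (use b in \<open>auto simp: power2_eq_square simp del: power_Suc\<close>)
  finally show ?case by (simp add: algebra_simps)
qed

definition step_const :: "nat \<Rightarrow> real" where "step_const k = 4 * (Suc k)\<^sup>2 * 4 ^ k"

text \<open>
First-order expansion of \<open>norm\<^sup>2\<close> raised to the power \<open>Suc k\<close>. With \<open>a = max (norm v) g\<close> the squared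
norm changes by at most \<open>3 * g * a\<close> and stays below \<open>4 * a\<^sup>2\<close>, so the second-order remainder is of
order \<open>g\<^sup>2 * a ^ (2 * k)\<close>.
\<close>

lemma norm_power_step:
  fixes v u :: "'h::real_inner" and g :: real
  assumes "norm u \<le> 1" "0 < g"
  shows "norm (v + g *\<^sub>R u) ^ (2 * Suc k) \<le> norm v ^ (2 * Suc k)
    + 2 * Suc k * g * norm v ^ (2 * k) * inner u v
    + step_const k * g\<^sup>2 * (norm v ^ (2 * k) + g ^ (2 * k))"
proof -
  define r a x where "r = norm v" and "a = max r g" and "x = (norm (v + g *\<^sub>R u))\<^sup>2"
  have a: "a > 0" "r \<le> a" "g \<le> a" "0 \<le> r" using assms by (auto simp: a_def r_def)
  have x_eq: "x = r\<^sup>2 + 2 * g * inner u v + g\<^sup>2 * (norm u)\<^sup>2"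
    by (simp add: x_def r_def power2_norm_eq_inner inner_add_left inner_add_right inner_commute)
      (simp add: power2_eq_square)
  have iuv: "\<bar>inner u v\<bar> \<le> r"
  proof -
    have "\<bar>inner u v\<bar> \<le> norm u * norm v" by (rule Cauchy_Schwarz_ineq2)
    also have "\<dots> \<le> 1 * r" using assms by (intro mult_mono) (auto simp: r_def)
    finally show ?thesis by simp
  qed
  have u2: "(norm u)\<^sup>2 \<le> 1" using assms by (simp add: power_le_one)
  have xv: "x - r\<^sup>2 \<le> 2 * g * inner u v + g\<^sup>2"
    using mult_left_mono[OF u2, of "g\<^sup>2"] by (simp add: x_eq)
  have D: "\<bar>x - r\<^sup>2\<bar> \<le> 3 * g * a"
  proof -
    have "\<bar>x - r\<^sup>2\<bar> \<le> \<bar>2 * g * inner u v\<bar> + \<bar>g\<^sup>2 * (norm u)\<^sup>2\<bar>" unfolding x_eq by linarith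
    also have "\<bar>2 * g * inner u v\<bar> \<le> 2 * g * a"
      using assms iuv a by (simp add: abs_mult)
    also have "\<bar>g\<^sup>2 * (norm u)\<^sup>2\<bar> \<le> g\<^sup>2" using u2 assms by (simp add: mult_left_le)
    also have "g\<^sup>2 \<le> g * a" using assms a by (simp add: power2_eq_square)
    finally show ?thesis by (simp add: algebra_simps)
  qed
  have rr: "r\<^sup>2 \<le> a\<^sup>2" using a by (intro power_mono) auto
  have "3 * g * a \<le> 3 * a\<^sup>2" using a by (simp add: power2_eq_square)
  with D rr have xM: "x \<le> 4 * a\<^sup>2" by linarith
  have D2: "(x - r\<^sup>2)\<^sup>2 \<le> 9 * g\<^sup>2 * a\<^sup>2"
    using power_mono[OF D, of 2] by (simp add: power_mult_distrib)
  have "4 * a\<^sup>2 * (x ^ Suc k - (r\<^sup>2) ^ Suc k - Suc k * (r\<^sup>2) ^ k * (x - r\<^sup>2))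
      \<le> (Suc k)\<^sup>2 * (4 * a\<^sup>2) ^ k * (x - r\<^sup>2)\<^sup>2"
    using xM rr by (intro Taylor_power) (auto simp: x_def intro: order.trans[OF rr])
  also have "\<dots> \<le> (Suc k)\<^sup>2 * (4 * a\<^sup>2) ^ k * (12 * g\<^sup>2 * a\<^sup>2)"
    using D2 by (intro mult_left_mono) (auto intro: order.trans)
  also have "\<dots> = 4 * a\<^sup>2 * (3 * (Suc k)\<^sup>2 * 4 ^ k * g\<^sup>2 * a ^ (2 * k))"
    by (simp add: power_mult_distrib power_mult)
  finally have "x ^ Suc k - (r\<^sup>2) ^ Suc k - Suc k * (r\<^sup>2) ^ k * (x - r\<^sup>2)
     \<le> 3 * (Suc k)\<^sup>2 * 4 ^ k * g\<^sup>2 * a ^ (2 * k)"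
    using a by (subst (asm) mult_le_cancel_left_pos) auto
  also have "\<dots> \<le> 3 * (Suc k)\<^sup>2 * 4 ^ k * g\<^sup>2 * (r ^ (2 * k) + g ^ (2 * k))"
    using a assms by (intro mult_left_mono) (auto simp: a_def max_def)
  finally have 1: "x ^ Suc k \<le> r ^ (2 * Suc k) + Suc k * r ^ (2 * k) * (x - r\<^sup>2)
      + 3 * (Suc k)\<^sup>2 * 4 ^ k * g\<^sup>2 * (r ^ (2 * k) + g ^ (2 * k))"
    unfolding power_mult by linarith
  also have "Suc k * r ^ (2 * k) * (x - r\<^sup>2) \<le> Suc k * r ^ (2 * k) * (2 * g * inner u v + g\<^sup>2)"
    using xv a by (intro mult_left_mono) auto
  finally have 2: "x ^ Suc k \<le> r ^ (2 * Suc k) + 2 * Suc k * g * r ^ (2 * k) * inner u v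
      + real (Suc k) * (g\<^sup>2 * r ^ (2 * k)) + 3 * (Suc k)\<^sup>2 * 4 ^ k * g\<^sup>2 * (r ^ (2 * k) + g ^ (2 * k))"
    by (simp add: algebra_simps del: power_Suc)
  have "real (Suc k) * (g\<^sup>2 * r ^ (2 * k)) \<le> ((Suc k)\<^sup>2 * 4 ^ k) * (g\<^sup>2 * (r ^ (2 * k) + g ^ (2 * k)))"
  proof (intro mult_mono)
    have "real (Suc k) * 1 \<le> (real (Suc k))\<^sup>2 * 4 ^ k"
      by (intro mult_mono) (auto simp: power2_eq_square)
    then show "real (Suc k) \<le> (Suc k)\<^sup>2 * 4 ^ k" by simp
  qed (use a assms in auto)
  with 2 have "x ^ Suc k \<le> r ^ (2 * Suc k) + 2 * Suc k * g * r ^ (2 * k) * inner u v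
      + step_const k * g\<^sup>2 * (r ^ (2 * k) + g ^ (2 * k))"
    by (simp add: step_const_def algebra_simps del: power_Suc)
  then show ?thesis unfolding x_def r_def power_mult .
qed

context prob_space
begin

lemma one_step_moment:
  fixes X :: "'a \<Rightarrow> 'h::{real_inner, complete_space, second_countable_topology}" and g \<kappa> :: real
  assumes X [measurable]: "X \<in> borel_measurable M" and g: "0 < g"
    and drift: "expectation (\<lambda>\<omega>. inner (sgn (X \<omega> - z)) (z - m))
      \<le> - \<kappa> * ((norm (z - m))\<^sup>2 / (1 + norm (z - m)))"
  shows "expectation (\<lambda>\<omega>. norm (z + g *\<^sub>R sgn (X \<omega> - z) - m) ^ (2 * Suc k))
    \<le> norm (z - m) ^ (2 * Suc k)
      - 2 * Suc k * \<kappa> * g * (norm (z - m) ^ (2 * Suc k) / (1 + norm (z - m)))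
      + step_const k * g\<^sup>2 * (norm (z - m) ^ (2 * k) + g ^ (2 * k))"
proof -
  define r where "r = norm (z - m)"
  define B where "B = step_const k * g\<^sup>2 * (r ^ (2 * k) + g ^ (2 * k))"
  have u: "norm (sgn (X \<omega> - z)) \<le> 1" for \<omega> by (simp add: norm_sgn)
  have eq: "z + g *\<^sub>R sgn (X \<omega> - z) - m = (z - m) + g *\<^sub>R sgn (X \<omega> - z)" for \<omega> by simp
  have int: "integrable M (\<lambda>\<omega>. norm (z + g *\<^sub>R sgn (X \<omega> - z) - m) ^ (2 * Suc k))"
  proof (rule integrable_const_bound[of _ "(r + g) ^ (2 * Suc k)"])
    have "norm (z + g *\<^sub>R sgn (X \<omega> - z) - m) \<le> r + g" for \<omega>
      using norm_triangle_ineq[of "z - m" "g *\<^sub>R sgn (X \<omega> - z)"] mult_left_mono[OF u, of g \<omega>] g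
      unfolding eq r_def by (simp only: norm_scaleR) linarith
    then show "AE \<omega> in M. norm (norm (z + g *\<^sub>R sgn (X \<omega> - z) - m) ^ (2 * Suc k)) \<le> (r + g) ^ (2 * Suc k)"
      unfolding real_norm_def power_abs abs_norm_cancel by (intro AE_I2 power_mono) auto
  qed measurable
  have "expectation (\<lambda>\<omega>. norm (z + g *\<^sub>R sgn (X \<omega> - z) - m) ^ (2 * Suc k))
    \<le> expectation (\<lambda>\<omega>. r ^ (2 * Suc k) + 2 * Suc k * g * r ^ (2 * k) * inner (sgn (X \<omega> - z)) (z - m) + B)"
  proof (rule integral_mono[OF int])
    show "norm (z + g *\<^sub>R sgn (X \<omega> - z) - m) ^ (2 * Suc k)
      \<le> r ^ (2 * Suc k) + 2 * Suc k * g * r ^ (2 * k) * inner (sgn (X \<omega> - z)) (z - m) + B" for \<omega>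
      using norm_power_step[OF u g, of "z - m" \<omega> k] unfolding eq r_def B_def .
  qed (use integrable_inner_sgn[OF X] in auto)
  also have "\<dots> = r ^ (2 * Suc k) + 2 * Suc k * g * r ^ (2 * k) * expectation (\<lambda>\<omega>. inner (sgn (X \<omega> - z)) (z - m)) + B"
    using integrable_inner_sgn[OF X, of z "z - m"] by (simp add: prob_space)
  also have "\<dots> \<le> r ^ (2 * Suc k) + 2 * Suc k * g * r ^ (2 * k) * (- \<kappa> * (r\<^sup>2 / (1 + r))) + B"
    using drift g by (intro add_mono mult_left_mono) (auto simp: r_def)
  also have "2 * Suc k * g * r ^ (2 * k) * (- \<kappa> * (r\<^sup>2 / (1 + r))) = - (2 * Suc k * \<kappa> * g * (r ^ (2 * Suc k) / (1 + r)))"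
    by (simp add: power2_eq_square)
  finally show ?thesis by (simp add: r_def B_def)
qed

end

section \<open>Independence of the iterate and the next sample\<close>

text \<open>
The sigma-algebra generated by \<open>Xs 1, \<dots>, Xs n\<close>, given as a pullback so that its sets are literally
events about the tuple of the first \<open>n\<close> samples.
\<close>

definition history :: "'a measure \<Rightarrow> (nat \<Rightarrow> 'a \<Rightarrow> 'h::topological_space) \<Rightarrow> nat \<Rightarrow> 'a measure"
  where "history M Xs n = vimage_algebra (space M) (\<lambda>\<omega>. \<lambda>i\<in>{1..n}. Xs i \<omega>) (\<Pi>\<^sub>M i\<in>{1..n}. borel)"

lemma space_history [simp]: "space (history M Xs n) = space M"
  by (simp add: history_def)

lemma measurable_history_component:
  assumes "1 \<le> i" "i \<le> n"
  shows "Xs i \<in> borel_measurable (history M Xs n)"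
proof -
  have "(\<lambda>\<omega>. \<lambda>i\<in>{1..n}. Xs i \<omega>) \<in> history M Xs n \<rightarrow>\<^sub>M (\<Pi>\<^sub>M i\<in>{1..n}. borel)"
    unfolding history_def by (rule measurable_vimage_algebra1) (auto simp: space_PiM)
  moreover have "(\<lambda>x. x i) \<in> (\<Pi>\<^sub>M i\<in>{1..n}. borel) \<rightarrow>\<^sub>M borel"
    by (rule measurable_component_singleton) (use assms in auto)
  ultimately have "(\<lambda>\<omega>. (\<lambda>i\<in>{1..n}. Xs i \<omega>) i) \<in> borel_measurable (history M Xs n)"
    by (rule measurable_compose)
  then show ?thesis using assms by simp
qed

lemma measurable_history_imp_measurable:
  assumes "f \<in> borel_measurable (history M Xs n)" "\<And>i. i \<ge> 1 \<Longrightarrow> Xs i \<in> borel_measurable M"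
  shows "f \<in> borel_measurable M"
proof -
  have "(\<lambda>\<omega>. \<omega>) \<in> M \<rightarrow>\<^sub>M history M Xs n"
    unfolding history_def
  proof (rule measurable_vimage_algebra2)
    show "(\<lambda>\<omega>. \<lambda>i\<in>{1..n}. Xs i \<omega>) \<in> M \<rightarrow>\<^sub>M (\<Pi>\<^sub>M i\<in>{1..n}. borel)"
      by (intro measurable_restrict assms(2)) auto
  qed auto
  from measurable_compose[OF this assms(1)] show ?thesis .
qed

lemma history_mono:
  assumes "f \<in> borel_measurable (history M Xs n)" "n \<le> n'"
  shows "f \<in> borel_measurable (history M Xs n')"
proof -
  have "(\<lambda>\<omega>. \<omega>) \<in> history M Xs n' \<rightarrow>\<^sub>M history M Xs n"
    unfolding history_def[of _ _ n]
  proof (rule measurable_vimage_algebra2)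
    show "(\<lambda>\<omega>. \<lambda>i\<in>{1..n}. Xs i \<omega>) \<in> history M Xs n' \<rightarrow>\<^sub>M (\<Pi>\<^sub>M i\<in>{1..n}. borel)"
      using assms(2) by (intro measurable_restrict measurable_history_component) auto
  qed auto
  from measurable_compose[OF this assms(1)] show ?thesis .
qed

text \<open>
The recursion holds only almost surely, so \<open>Z n\<close> itself need not be measurable with respect to the
history; running the recursion everywhere yields a version that is.
\<close>

lemma adapted_version:
  fixes Xs Z :: "nat \<Rightarrow> 'a \<Rightarrow> 'h::{real_inner, complete_space, second_countable_topology}"
  assumes Z1: "Z 1 \<in> borel_measurable (vimage_algebra (space M) (Xs 1) borel)"
    and Z_rec: "\<And>n. n \<ge> 1 \<Longrightarrow> AE \<omega> in M. Z (n + 1) \<omega> = Z n \<omega> + \<gamma> n *\<^sub>R sgn (Xs (n + 1) \<omega> - Z n \<omega>)"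
    and "n \<ge> 1"
  shows "\<exists>Z'. Z' \<in> borel_measurable (history M Xs n) \<and> (AE \<omega> in M. Z n \<omega> = Z' \<omega>)"
  using \<open>n \<ge> 1\<close>
proof (induction n rule: dec_induct)
  case base
  have "(\<lambda>\<omega>. \<omega>) \<in> history M Xs 1 \<rightarrow>\<^sub>M vimage_algebra (space M) (Xs 1) borel"
    by (rule measurable_vimage_algebra2) (auto intro: measurable_history_component)
  from measurable_compose[OF this Z1] show ?case by auto
next
  case (step n)
  then obtain Z' where Z': "Z' \<in> borel_measurable (history M Xs n)" "AE \<omega> in M. Z n \<omega> = Z' \<omega>"
    by blast
  have [measurable]: "Z' \<in> borel_measurable (history M Xs (Suc n))"
    "Xs (Suc n) \<in> borel_measurable (history M Xs (Suc n))"
    using history_mono[OF Z'(1)] by (auto intro: measurable_history_component)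
  have "(\<lambda>\<omega>. Z' \<omega> + \<gamma> n *\<^sub>R sgn (Xs (Suc n) \<omega> - Z' \<omega>)) \<in> borel_measurable (history M Xs (Suc n))"
    by measurable
  moreover have "AE \<omega> in M. Z (Suc n) \<omega> = Z' \<omega> + \<gamma> n *\<^sub>R sgn (Xs (Suc n) \<omega> - Z' \<omega>)"
    using Z_rec[OF step(1)] Z'(2) by eventually_elim simp
  ultimately show ?case by blast
qed

context prob_space
begin

text \<open>
Events of the history are determined by the first \<open>n\<close> samples, which are jointly independent of any
later one.
\<close>

lemma law_of_iterate_and_next_sample:
  fixes Xs :: "nat \<Rightarrow> 'a \<Rightarrow> 'h::{real_inner, complete_space, second_countable_topology}"
  assumes indep: "indep_vars (\<lambda>_. borel) Xs {1..}"
    and Z': "Z' \<in> borel_measurable (history M Xs n)" and j: "n < j"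
  shows "distr M (borel \<Otimes>\<^sub>M borel) (\<lambda>\<omega>. (Z' \<omega>, Xs j \<omega>))
    = distr M borel Z' \<Otimes>\<^sub>M distr M borel (Xs j)"
proof -
  define Y where "Y = (\<lambda>\<omega>. \<lambda>i\<in>{1..n}. Xs i \<omega>)"
  define W where "W = (\<lambda>\<omega>. \<lambda>i\<in>{j}. Xs i \<omega>)"
  have Xm: "Xs i \<in> borel_measurable M" if "i \<ge> 1" for i
    using indep that unfolding indep_vars_def2 by simp
  have Xm' [measurable]: "Xs j \<in> borel_measurable M" using j by (intro Xm) simp
  have YW: "indep_var (\<Pi>\<^sub>M i\<in>{1..n}. borel) Y (\<Pi>\<^sub>M i\<in>{j}. borel) W"
    unfolding Y_def W_def using j by (intro indep_var_restrict[OF indep]) auto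
  have Zm [measurable]: "Z' \<in> borel_measurable M"
    by (rule measurable_history_imp_measurable[OF Z' Xm])
  interpret P1: prob_space "distr M borel Z'" by (rule prob_space_distr) simp
  interpret P2: prob_space "distr M borel (Xs j)" by (rule prob_space_distr) simp
  show ?thesis
  proof (rule pair_measure_eqI[symmetric])
    fix A B assume "A \<in> sets (distr M borel Z')" "B \<in> sets (distr M borel (Xs j))"
    then have AB [measurable]: "A \<in> sets borel" "B \<in> sets borel" by auto
    have "Z' -` A \<inter> space (history M Xs n) \<in> sets (history M Xs n)"
      using Z' AB(1) by (rule measurable_sets)
    then obtain S where S: "S \<in> sets (\<Pi>\<^sub>M i\<in>{1..n}. borel)" "Z' -` A \<inter> space M = Y -` S \<inter> space M"
      unfolding history_def
      by (subst (asm) sets_vimage_algebra2) (auto simp: Y_def space_PiM)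
    define T where "T = {f \<in> space (\<Pi>\<^sub>M i\<in>{j}. borel). f j \<in> B}"
    have T: "T \<in> sets (\<Pi>\<^sub>M i\<in>{j}. borel)" unfolding T_def by measurable
    have W: "W -` T \<inter> space M = Xs j -` B \<inter> space M"
      by (auto simp: W_def T_def space_PiM)
    have "prob (Z' -` A \<inter> space M \<inter> (Xs j -` B \<inter> space M))
      = prob ((\<lambda>\<omega>. (Y \<omega>, W \<omega>)) -` (S \<times> T) \<inter> space M)"
      unfolding S(2) W[symmetric] by (rule arg_cong[of _ _ prob]) auto
    also have "\<dots> = prob (Z' -` A \<inter> space M) * prob (Xs j -` B \<inter> space M)"
      using indep_varD[OF YW S(1) T] unfolding S(2) W .
    finally have *: "prob (Z' -` A \<inter> space M \<inter> (Xs j -` B \<inter> space M))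
      = prob (Z' -` A \<inter> space M) * prob (Xs j -` B \<inter> space M)" .
    have "(\<lambda>\<omega>. (Z' \<omega>, Xs j \<omega>)) -` (A \<times> B) \<inter> space M = Z' -` A \<inter> space M \<inter> (Xs j -` B \<inter> space M)"
      by auto
    then show "emeasure (distr M borel Z') A * emeasure (distr M borel (Xs j)) B
      = emeasure (distr M (borel \<Otimes>\<^sub>M borel) (\<lambda>\<omega>. (Z' \<omega>, Xs j \<omega>))) (A \<times> B)"
      using * by (simp add: emeasure_distr emeasure_eq_measure ennreal_mult'')
  qed (auto intro: P1.sigma_finite_measure_axioms P2.sigma_finite_measure_axioms)
qed

text \<open>
This replaces conditioning on the past: when the joint law is a product, an inequality for the mean
over the new sample, valid for each fixed value \<open>z\<close> of the iterate, may be integrated over \<open>z\<close>.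
\<close>

lemma expectation_next_iterate:
  fixes Xs Z :: "nat \<Rightarrow> 'a \<Rightarrow> 'h::{real_inner, complete_space, second_countable_topology}"
  assumes law: "distr M (borel \<Otimes>\<^sub>M borel) (\<lambda>\<omega>. (U \<omega>, Y \<omega>)) = distr M borel U \<Otimes>\<^sub>M distr M borel X"
    and [measurable]: "U \<in> borel_measurable M" "Y \<in> borel_measurable M" "X \<in> borel_measurable M"
      "case_prod f \<in> borel_measurable (borel \<Otimes>\<^sub>M borel)" "b \<in> borel_measurable borel"
    and int: "integrable M (\<lambda>\<omega>. f (U \<omega>) (Y \<omega>))" "integrable M (\<lambda>\<omega>. b (U \<omega>))"
    and le: "\<And>z. expectation (\<lambda>\<omega>. f z (X \<omega>)) \<le> (b z :: real)"
  shows "expectation (\<lambda>\<omega>. f (U \<omega>) (Y \<omega>)) \<le> expectation (\<lambda>\<omega>. b (U \<omega>))"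
proof -
  interpret P1: prob_space "distr M borel U" by (rule prob_space_distr) simp
  interpret P2: prob_space "distr M borel X" by (rule prob_space_distr) simp
  interpret P: pair_sigma_finite "distr M borel U" "distr M borel X" ..
  have intp: "integrable (distr M borel U \<Otimes>\<^sub>M distr M borel X) (case_prod f)"
    unfolding law[symmetric] using int(1) by (subst integrable_distr_eq) auto
  have "expectation (\<lambda>\<omega>. f (U \<omega>) (Y \<omega>)) = integral\<^sup>L (distr M (borel \<Otimes>\<^sub>M borel) (\<lambda>\<omega>. (U \<omega>, Y \<omega>))) (case_prod f)"
    by (subst integral_distr) auto
  also have "\<dots> = (\<integral>z. (\<integral>x. f z x \<partial>distr M borel X) \<partial>distr M borel U)"
    unfolding law using P.integral_fst'[OF intp] by simp
  also have "\<dots> \<le> (\<integral>z. b z \<partial>distr M borel U)"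
  proof (rule integral_mono)
    show "integrable (distr M borel U) (\<lambda>z. \<integral>x. f z x \<partial>distr M borel X)"
      using P.integrable_fst'[OF intp] by simp
    show "integrable (distr M borel U) b"
      using int(2) by (subst integrable_distr_eq) auto
    show "(\<integral>x. f z x \<partial>distr M borel X) \<le> b z" for z
    proof -
      have "(\<lambda>x. case_prod f (z, x)) \<in> borel_measurable borel" by measurable
      then show ?thesis using le[of z] by (subst integral_distr) auto
    qed
  qed
  also have "\<dots> = expectation (\<lambda>\<omega>. b (U \<omega>))" by (subst integral_distr) auto
  finally show ?thesis .
qed

end

section \<open>Moments of the iterates\<close>

text \<open>
Each step has length at most \<open>\<bar>\<gamma> n\<bar>\<close>. The bound depends on \<open>n\<close>; it serves only to make all moments
finite.
\<close>

lemma AE_iterate_bounded: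
  fixes Xs Z :: "nat \<Rightarrow> 'a \<Rightarrow> 'h::real_inner"
  assumes "\<exists>B. AE \<omega> in M. norm (Z 1 \<omega>) \<le> B"
    and Z_rec: "\<And>n. n \<ge> 1 \<Longrightarrow> AE \<omega> in M. Z (n + 1) \<omega> = Z n \<omega> + \<gamma> n *\<^sub>R sgn (Xs (n + 1) \<omega> - Z n \<omega>)"
    and "n \<ge> 1"
  shows "\<exists>B. AE \<omega> in M. norm (Z n \<omega> - m) \<le> B"
  using \<open>n \<ge> 1\<close>
proof (induction n rule: dec_induct)
  case base
  obtain B where "AE \<omega> in M. norm (Z 1 \<omega>) \<le> B" using assms(1) by blast
  then have "AE \<omega> in M. norm (Z 1 \<omega> - m) \<le> B + norm m"
    by eventually_elim (rule norm_triangle_le_diff, simp)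
  then show ?case by blast
next
  case (step n)
  then obtain B where "AE \<omega> in M. norm (Z n \<omega> - m) \<le> B" by blast
  then have "AE \<omega> in M. norm (Z (Suc n) \<omega> - m) \<le> B + \<bar>\<gamma> n\<bar>"
    using Z_rec[OF step(1)]
  proof eventually_elim
    case (elim \<omega>)
    then have "Z (Suc n) \<omega> - m = (Z n \<omega> - m) + \<gamma> n *\<^sub>R sgn (Xs (Suc n) \<omega> - Z n \<omega>)" by simp
    also have "norm \<dots> \<le> norm (Z n \<omega> - m) + \<bar>\<gamma> n\<bar> * norm (sgn (Xs (Suc n) \<omega> - Z n \<omega>))"
      using norm_triangle_ineq[of "Z n \<omega> - m" "\<gamma> n *\<^sub>R sgn (Xs (Suc n) \<omega> - Z n \<omega>)"] by simp
    also have "\<dots> \<le> B + \<bar>\<gamma> n\<bar> * 1"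
      using elim by (intro add_mono mult_left_mono) (auto simp: norm_sgn)
    finally show ?case by simp
  qed
  then show ?case by blast
qed

context prob_space
begin

lemma integrable_norm_power:
  fixes U :: "'a \<Rightarrow> 'h::{real_inner, complete_space, second_countable_topology}"
  assumes [measurable]: "U \<in> borel_measurable M" and bounded: "AE \<omega> in M. norm (U \<omega> - m) \<le> B"
  shows "integrable M (\<lambda>\<omega>. norm (U \<omega> - m) ^ p)"
  using bounded
  by (intro integrable_const_bound[of _ "B ^ p"])
    (auto elim!: eventually_mono simp: power_abs intro!: power_mono)

lemma integrable_damped_norm_power:
  fixes U :: "'a \<Rightarrow> 'h::{real_inner, complete_space, second_countable_topology}"
  assumes U [measurable]: "U \<in> borel_measurable M" and bounded: "AE \<omega> in M. norm (U \<omega> - m) \<le> B"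
  shows "integrable M (\<lambda>\<omega>. norm (U \<omega> - m) ^ p / (1 + norm (U \<omega> - m)))"
proof (rule Bochner_Integration.integrable_bound[OF integrable_norm_power[OF assms, of p]])
  have "a / (1 + norm z) \<le> a" if "0 \<le> a" for a :: real and z :: 'h
    using that by (simp add: field_simps add_pos_nonneg)
  then show "AE \<omega> in M. norm (norm (U \<omega> - m) ^ p / (1 + norm (U \<omega> - m)))
      \<le> norm (norm (U \<omega> - m) ^ p)"
    by (intro AE_I2) (simp add: power_abs)
qed measurable

lemma iterate_moment_step:
  fixes X :: "'a \<Rightarrow> 'h::{real_inner, complete_space, second_countable_topology}"
    and U U' Y :: "'a \<Rightarrow> 'h" and g \<kappa> B :: real
  assumes law: "distr M (borel \<Otimes>\<^sub>M borel) (\<lambda>\<omega>. (U \<omega>, Y \<omega>)) = distr M borel U \<Otimes>\<^sub>M distr M borel X"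
    and [measurable]: "U \<in> borel_measurable M" "U' \<in> borel_measurable M" "Y \<in> borel_measurable M"
      "X \<in> borel_measurable M"
    and U': "AE \<omega> in M. U' \<omega> = U \<omega> + g *\<^sub>R sgn (Y \<omega> - U \<omega>)"
    and bounded: "AE \<omega> in M. norm (U \<omega> - m) \<le> B"
    and g: "0 < g"
    and drift: "\<And>h. expectation (\<lambda>\<omega>. inner (sgn (X \<omega> - h)) (h - m))
      \<le> - \<kappa> * ((norm (h - m))\<^sup>2 / (1 + norm (h - m)))"
  shows "expectation (\<lambda>\<omega>. norm (U' \<omega> - m) ^ (2 * Suc k))
    \<le> expectation (\<lambda>\<omega>. norm (U \<omega> - m) ^ (2 * Suc k))
      - 2 * Suc k * \<kappa> * g * expectation (\<lambda>\<omega>. norm (U \<omega> - m) ^ (2 * Suc k) / (1 + norm (U \<omega> - m)))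
      + step_const k * g\<^sup>2 * (expectation (\<lambda>\<omega>. norm (U \<omega> - m) ^ (2 * k)) + g ^ (2 * k))"
proof -
  define b where "b = (\<lambda>z. norm (z - m) ^ (2 * Suc k)
      - 2 * Suc k * \<kappa> * g * (norm (z - m) ^ (2 * Suc k) / (1 + norm (z - m)))
      + step_const k * g\<^sup>2 * (norm (z - m) ^ (2 * k) + g ^ (2 * k)))"
  define f where "f = (\<lambda>z x. norm (z + g *\<^sub>R sgn (x - z) - m) ^ (2 * Suc k))"
  have [measurable]: "case_prod f \<in> borel_measurable (borel \<Otimes>\<^sub>M borel)" "b \<in> borel_measurable borel"
    unfolding f_def b_def by measurable
  have int: "integrable M (\<lambda>\<omega>. norm (U \<omega> - m) ^ p)" for p
    by (rule integrable_norm_power[OF _ bounded]) simp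
  have intd: "integrable M (\<lambda>\<omega>. norm (U \<omega> - m) ^ p / (1 + norm (U \<omega> - m)))" for p
    by (rule integrable_damped_norm_power[OF _ bounded]) simp
  have split: "expectation (\<lambda>\<omega>. f1 \<omega> - c1 * f2 \<omega> + c2 * (f3 \<omega> + c3))
      = expectation f1 - c1 * expectation f2 + c2 * (expectation f3 + c3)"
    if "integrable M f1" "integrable M f2" "integrable M f3"
    for f1 f2 f3 :: "'a \<Rightarrow> real" and c1 c2 c3 :: real
    using that by (simp add: prob_space)
  have "expectation (\<lambda>\<omega>. norm (U' \<omega> - m) ^ (2 * Suc k)) = expectation (\<lambda>\<omega>. f (U \<omega>) (Y \<omega>))"
    using U' by (intro integral_cong_AE) (auto simp: f_def elim: eventually_mono)
  also have "\<dots> \<le> expectation (\<lambda>\<omega>. b (U \<omega>))"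
  proof (rule expectation_next_iterate[OF law])
    show "integrable M (\<lambda>\<omega>. f (U \<omega>) (Y \<omega>))"
    proof (rule integrable_const_bound[of _ "(B + g) ^ (2 * Suc k)"])
      show "AE \<omega> in M. norm (f (U \<omega>) (Y \<omega>)) \<le> (B + g) ^ (2 * Suc k)"
        using bounded
      proof eventually_elim
        case (elim \<omega>)
        have "norm ((U \<omega> - m) + g *\<^sub>R sgn (Y \<omega> - U \<omega>)) \<le> norm (U \<omega> - m) + norm (g *\<^sub>R sgn (Y \<omega> - U \<omega>))"
          by (rule norm_triangle_ineq)
        also have "\<dots> \<le> B + g" using elim g by (intro add_mono) (auto simp: norm_sgn)
        finally have "norm (U \<omega> + g *\<^sub>R sgn (Y \<omega> - U \<omega>) - m) \<le> B + g" by (simp add: algebra_simps)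
        then show ?case unfolding f_def real_norm_def power_abs abs_norm_cancel by (rule power_mono) simp
      qed
    qed measurable
    show "integrable M (\<lambda>\<omega>. b (U \<omega>))" 
      unfolding b_def
      by (intro Bochner_Integration.integrable_add Bochner_Integration.integrable_diff
          integrable_mult_right integrable_const int intd)
    show "expectation (\<lambda>\<omega>. f z (X \<omega>)) \<le> b z" for z
      unfolding f_def b_def using g drift by (intro one_step_moment) auto
  qed measurable
  also have "\<dots> = expectation (\<lambda>\<omega>. norm (U \<omega> - m) ^ (2 * Suc k))
      - 2 * Suc k * \<kappa> * g * expectation (\<lambda>\<omega>. norm (U \<omega> - m) ^ (2 * Suc k) / (1 + norm (U \<omega> - m)))
      + step_const k * g\<^sup>2 * (expectation (\<lambda>\<omega>. norm (U \<omega> - m) ^ (2 * k)) + g ^ (2 * k))"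
    unfolding b_def by (rule split[OF int intd int])
  finally show ?thesis .
qed

end

text \<open>
For \<open>r \<le> L\<close> the damping factor \<open>1 / (1 + r)\<close> is at least \<open>1 / (1 + L)\<close>; for \<open>r > L\<close> the left-hand
side is at most \<open>0\<close>. This trades the damping for a higher moment divided by a power of \<open>L\<close>.
\<close>

lemma truncated_drift:
  fixes r L :: real
  assumes "0 \<le> r" "1 \<le> L"
  shows "r ^ (2 * p) - r ^ (2 * (p + q)) / L ^ (2 * q) \<le> (1 + L) * (r ^ (2 * p) / (1 + r))"
proof (cases "r \<le> L")
  case True
  have "r ^ (2 * p) * (1 + r) \<le> r ^ (2 * p) * (1 + L)" using True assms by (intro mult_left_mono) auto
  then have "r ^ (2 * p) \<le> (1 + L) * (r ^ (2 * p) / (1 + r))" using assms by (simp add: field_simps)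
  moreover have "0 \<le> r ^ (2 * (p + q)) / L ^ (2 * q)" using assms by simp
  ultimately show ?thesis by linarith
next
  case False
  then have "L ^ (2 * q) \<le> r ^ (2 * q)" using assms by (intro power_mono) auto
  then have "r ^ (2 * p) * L ^ (2 * q) \<le> r ^ (2 * p) * r ^ (2 * q)" using assms by (intro mult_left_mono) auto
  then have "r ^ (2 * p) \<le> r ^ (2 * (p + q)) / L ^ (2 * q)"
    using assms by (simp add: pos_le_divide_eq power_add distrib_left)
  moreover have "0 \<le> (1 + L) * (r ^ (2 * p) / (1 + r))" using assms by simp
  ultimately show ?thesis by linarith
qed

section \<open>Decay rates from the moment recursion\<close>

text \<open>
A contraction by \<open>1 - a * n powr - \<rho>\<close> with \<open>\<rho> < 1\<close> is stronger than the relative decrease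
\<open>\<eta> / n\<close> of the sequence \<open>n powr - \<eta>\<close> per step, so the sequence settles at the ratio of the
perturbation to the contraction.
\<close>

lemma Chung_lemma:
  fixes x :: "nat \<Rightarrow> real"
  assumes x0: "\<And>n. 0 \<le> x n" and "0 < a" "0 \<le> b" "0 \<le> \<eta>" "\<rho> < 1" "0 < \<rho>"
    and rec: "\<And>n. n \<ge> 1 \<Longrightarrow> x (n + 1) \<le> (1 - a * real n powr - \<rho>) * x n + b * real n powr (- \<rho> - \<eta>)"
  shows "\<exists>K\<ge>0. \<forall>n\<ge>1. x n \<le> K * real n powr - \<eta>"
proof -
  have "((\<lambda>n. a * real n powr - \<rho>) \<longlongrightarrow> 0) sequentially"
    using \<open>0 < \<rho>\<close> by real_asymp
  then have e1: "eventually (\<lambda>n. a * real n powr - \<rho> < 1) sequentially"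
    by (rule order_tendstoD) simp
  have "((\<lambda>n. \<eta> * real n powr (\<rho> - 1)) \<longlongrightarrow> 0) sequentially"
    using \<open>\<rho> < 1\<close> by real_asymp
  then have e2: "eventually (\<lambda>n. \<eta> * real n powr (\<rho> - 1) < a / 2) sequentially"
    by (rule order_tendstoD) (use \<open>0 < a\<close> in simp)
  obtain n0 where n0: "n0 \<ge> 1" "\<And>n. n \<ge> n0 \<Longrightarrow> a * real n powr - \<rho> < 1 \<and> \<eta> * real n powr (\<rho> - 1) < a / 2"
    using eventually_conj[OF eventually_conj[OF e1 e2] eventually_ge_at_top[of 1]]
    by (auto simp: eventually_sequentially)
  define K where "K = 2 * b / a + (\<Sum>n\<le>n0. x n * real n powr \<eta>)"
  have K: "K \<ge> 0" "2 * b / a \<le> K"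
    using assms by (auto simp: K_def intro!: sum_nonneg add_nonneg_nonneg)
  have small: "x n \<le> K * real n powr - \<eta>" if "1 \<le> n" "n \<le> n0" for n
  proof -
    have "x n * real n powr \<eta> \<le> (\<Sum>n\<le>n0. x n * real n powr \<eta>)"
      using that x0 by (intro member_le_sum) auto
    also have "\<dots> \<le> K" using assms by (simp add: K_def)
    finally show ?thesis using that by (simp add: powr_minus field_simps)
  qed
  have large: "x n \<le> K * real n powr - \<eta>" if "n0 \<le> n" for n
    using that
  proof (induction n rule: dec_induct)
    case base
    then show ?case using small n0 by simp
  next
    case (step n)
    have n: "real n > 0" "n \<ge> 1" using step n0 by auto
    define q where "q = real n powr - \<rho>"
    have q: "0 < q" "a * q < 1" using n n0(2)[of n] step by (auto simp: q_def)
    have "\<eta> / n = \<eta> * real n powr (\<rho> - 1) * q"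
      using n by (simp add: q_def powr_diff powr_minus_divide)
    also have "\<dots> \<le> a / 2 * q" using n0(2)[of n] step q by (intro mult_right_mono) auto
    finally have \<eta>n: "\<eta> / n \<le> a * q / 2" by simp
    \<comment> \<open>One step costs \<open>K * \<eta> / n\<close>, at most half of the gain \<open>K * a * q\<close>; the other half pays for \<open>b\<close>.\<close>
    have "1 - \<eta> / n \<le> exp (- (\<eta> / n))" using exp_ge_add_one_self[of "- (\<eta> / n)"] by simp
    also have "\<dots> = exp (1 / n) powr - \<eta>" by (simp add: exp_powr_real)
    also have "\<dots> \<le> (1 + 1 / n) powr - \<eta>"
      using assms n by (intro powr_mono2') (auto simp: exp_ge_add_one_self add_pos_pos)
    finally have bern: "1 - \<eta> / n \<le> (1 + 1 / n) powr - \<eta>" .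
    have "real (Suc n) = real n * (1 + 1 / n)" using n by (simp add: field_simps)
    then have pSuc: "real (Suc n) powr - \<eta> = real n powr - \<eta> * (1 + 1 / n) powr - \<eta>"
      using n by (simp add: powr_mult)
    have "x (Suc n) \<le> (1 - a * q) * x n + b * (q * real n powr - \<eta>)"
      using rec[of n] n by (simp add: q_def powr_add[symmetric])
    also have "\<dots> \<le> (1 - a * q) * (K * real n powr - \<eta>) + (K * a / 2) * (q * real n powr - \<eta>)"
      using step.IH q K \<open>0 < a\<close>
      by (intro add_mono mult_left_mono mult_right_mono) (auto simp: field_simps)
    also have "\<dots> = K * real n powr - \<eta> * (1 - a * q / 2)" by (simp add: algebra_simps)
    also have "\<dots> \<le> K * real n powr - \<eta> * (1 - \<eta> / n)"
      using \<eta>n K by (intro mult_left_mono) auto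
    also have "\<dots> \<le> K * real n powr - \<eta> * (1 + 1 / n) powr - \<eta>"
      using bern K by (intro mult_left_mono) auto
    finally show ?case using pSuc by (simp add: mult.assoc)
  qed
  have "x n \<le> K * real n powr - \<eta>" if "n \<ge> 1" for n
    using small[of n] large[of n] that by (cases "n \<le> n0") auto
  then show ?thesis using K(1) by blast
qed

text \<open>
The recursion as a statement about numbers: \<open>s p n\<close> plays the moment of order \<open>2 * p\<close> at time \<open>n\<close>
and \<open>t p n\<close> the damped moment, with integrand divided by \<open>1 + r\<^sub>n\<close>, in which the drift is
expressed.
\<close>

locale moment_recursion =
  fixes s t :: "nat \<Rightarrow> nat \<Rightarrow> real" and \<kappa> c \<alpha> :: real and C :: "nat \<Rightarrow> real" and \<gamma> :: "nat \<Rightarrow> real"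
  assumes s_nonneg: "\<And>p n. 0 \<le> s p n" and t_nonneg: "\<And>p n. 0 \<le> t p n"
    and C_nonneg: "\<And>k. 0 \<le> C k"
    and s_0: "\<And>n. s 0 n \<le> 1"
    and \<kappa>: "0 < \<kappa>" and c: "0 < c" and \<alpha>: "1 / 2 < \<alpha>" "\<alpha> < 1"
    and \<gamma>: "\<And>n. n \<ge> 1 \<Longrightarrow> \<gamma> n = c * real n powr - \<alpha>"
    and t_ge: "\<And>p q n L. n \<ge> 1 \<Longrightarrow> L \<ge> 1 \<Longrightarrow> s p n - s (p + q) n / L ^ (2 * q) \<le> (1 + L) * t p n"
    and recursion: "\<And>k n. n \<ge> 1 \<Longrightarrow> s (Suc k) (n + 1) \<le>
        s (Suc k) n - 2 * Suc k * \<kappa> * \<gamma> n * t (Suc k) n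
        + C k * (\<gamma> n)\<^sup>2 * (s k n + \<gamma> n ^ (2 * k))"

begin

lemma \<gamma>_power:
  assumes "n \<ge> 1"
  shows "(\<gamma> n) ^ k = c ^ k * real n powr (- (k * \<alpha>))"
  using assms by (simp add: \<gamma> power_mult_distrib powr_realpow[symmetric] powr_powr mult.commute
      flip: powr_realpow)

lemma \<gamma>_bounds: "n \<ge> 1 \<Longrightarrow> 0 < \<gamma> n" "n \<ge> 1 \<Longrightarrow> \<gamma> n \<le> c"
proof -
  assume n: "n \<ge> 1"
  then show "0 < \<gamma> n" using c by (simp add: \<gamma>)
  have "real n powr - \<alpha> \<le> real n powr 0" using n \<alpha> by (intro powr_mono) auto
  then show "\<gamma> n \<le> c" using n c by (simp add: \<gamma>)
qed

text \<open>
Here the drift is only used for its sign: the perturbation is of order \<open>\<gamma>\<^sub>n\<^sup>2\<close> once the previous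
moment is bounded, and \<open>\<gamma>\<^sub>n\<^sup>2\<close> is summable because \<open>\<alpha> > 1 / 2\<close>.
\<close>

lemma moments_bounded: "\<exists>K. \<forall>n\<ge>1. s p n \<le> K"
proof (induction p)
  case 0
  then show ?case using s_0 by blast
next
  case (Suc k)
  then obtain K where K: "\<And>n. n \<ge> 1 \<Longrightarrow> s k n \<le> K" by blast
  define b where "b = (\<lambda>n. C k * (K + c ^ (2 * k)) * c\<^sup>2 * real n powr (- (2 * \<alpha>)))"
  have K0: "0 \<le> K" using K[of 1] s_nonneg[of k 1] by simp
  have b0: "0 \<le> b n" for n using C_nonneg K0 c by (auto simp: b_def)
  have b: "summable b"
    unfolding b_def using \<alpha> by (intro summable_mult) (simp add: summable_real_powr_iff)
  have step: "s (Suc k) (n + 1) \<le> s (Suc k) n + b n" if n: "n \<ge> 1" for n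
  proof -
    have "0 \<le> 2 * Suc k * \<kappa> * \<gamma> n * t (Suc k) n"
      using \<kappa> \<gamma>_bounds[OF n] t_nonneg by simp
    moreover have "C k * (\<gamma> n)\<^sup>2 * (s k n + \<gamma> n ^ (2 * k)) \<le> C k * (\<gamma> n)\<^sup>2 * (K + c ^ (2 * k))"
      using K[OF n] C_nonneg \<gamma>_bounds[OF n] by (intro mult_left_mono add_mono power_mono) auto
    moreover have "\<dots> = b n" using \<gamma>_power[OF n, of 2] by (simp add: b_def)
    ultimately show ?thesis using recursion[OF n, of k] by linarith
  qed
  have "s (Suc k) n \<le> s (Suc k) 1 + (\<Sum>i<n. b i)" if "n \<ge> 1" for n
    using that
  proof (induction n rule: dec_induct)
    case base
    then show ?case using b0 by simp
  next
    case (step n)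
    then show ?case using \<open>\<And>n. n \<ge> 1 \<Longrightarrow> _ \<le> _ + b n\<close>[of n] by simp
  qed
  moreover have "(\<Sum>i<n. b i) \<le> suminf b" for n
    using b b0 by (intro sum_le_suminf) auto
  ultimately have "s (Suc k) n \<le> s (Suc k) 1 + suminf b" if "n \<ge> 1" for n
    using that by (blast intro: order.trans[OF _ add_left_mono])
  then show ?case by blast
qed

text \<open>
The bootstrapping step, with truncation level \<open>L = n powr \<epsilon>\<close>. The recursion becomes a contraction
with exponent \<open>\<alpha> + \<epsilon>\<close>, and the three bounds on \<open>\<eta>\<close> say that the three perturbations, coming from the
truncated higher moment, the next lower moment, and the pure step-size term, are all of order
\<open>n powr (- (\<alpha> + \<epsilon>) - \<eta>)\<close>.
\<close>

lemma rate_step: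
  assumes "0 \<le> \<epsilon>" "\<alpha> + \<epsilon> < 1" "0 \<le> \<eta>"
    and lower: "\<exists>K\<ge>0. \<forall>n\<ge>1. s k n \<le> K * real n powr - \<sigma>"
    and higher: "\<exists>K\<ge>0. \<forall>n\<ge>1. s (Suc k + q) n \<le> K * real n powr - \<tau>"
    and \<eta>1: "\<eta> \<le> \<tau> + 2 * real q * \<epsilon>" and \<eta>2: "\<eta> \<le> \<sigma> + \<alpha> - \<epsilon>" and \<eta>3: "\<eta> \<le> (2 * real k + 1) * \<alpha> - \<epsilon>"
  shows "\<exists>K\<ge>0. \<forall>n\<ge>1. s (Suc k) n \<le> K * real n powr - \<eta>"
proof -
  obtain K1 where K1: "K1 \<ge> 0" "\<And>n. n \<ge> 1 \<Longrightarrow> s k n \<le> K1 * real n powr - \<sigma>"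
    using lower by blast
  obtain K2 where K2: "K2 \<ge> 0" "\<And>n. n \<ge> 1 \<Longrightarrow> s (Suc k + q) n \<le> K2 * real n powr - \<tau>"
    using higher by blast
  define A where "A = Suc k * \<kappa> * c"
  define b where "b = 2 * A * K2 + C k * c\<^sup>2 * (K1 + c ^ (2 * k))"
  have A: "A > 0" using \<kappa> c by (simp add: A_def)
  have b: "b \<ge> 0" using A K1 K2 C_nonneg[of k] c by (simp add: b_def)
  show ?thesis
  proof (rule Chung_lemma[where a = A and b = b and \<rho> = "\<alpha> + \<epsilon>"])
    fix n :: nat assume n: "n \<ge> 1"
    define L where "L = real n powr \<epsilon>"
    have L: "L \<ge> 1" using n assms by (simp add: L_def ge_one_powr_ge_zero)
    define w where "w = real n powr (- (\<alpha> + \<epsilon>) - \<eta>)"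
    have mono: "real n powr u \<le> w" if "u \<le> - (\<alpha> + \<epsilon>) - \<eta>" for u
      using that n unfolding w_def by (intro powr_mono) auto
    have L2q: "L ^ (2 * q) = real n powr (2 * real q * \<epsilon>)"
      using n unfolding L_def by (simp add: powr_powr mult.commute flip: powr_realpow)
    have g: "\<gamma> n / L = c * real n powr - (\<alpha> + \<epsilon>)"
      using n by (simp add: \<gamma> L_def powr_diff powr_minus_divide powr_add field_simps)
    have "A / c * \<gamma> n / L = A / c * (\<gamma> n / L)" by simp
    then have gA: "A / c * \<gamma> n / L = A * real n powr - (\<alpha> + \<epsilon>)"
      unfolding g using c by simp
    have "s (Suc k) n - s (Suc k + q) n / L ^ (2 * q) \<le> (1 + L) * t (Suc k) n"
      by (rule t_ge[OF n L])
    also have "\<dots> \<le> 2 * L * t (Suc k) n"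
      using L t_nonneg by (intro mult_right_mono) auto
    finally have "(s (Suc k) n - s (Suc k + q) n / L ^ (2 * q)) * (A / c * \<gamma> n / L)
        \<le> (2 * L * t (Suc k) n) * (A / c * \<gamma> n / L)"
      using A c L \<gamma>_bounds(1)[OF n] by (intro mult_right_mono) auto
    also have "\<dots> = 2 * Suc k * \<kappa> * \<gamma> n * t (Suc k) n"
      using L c by (simp add: A_def field_simps)
    also have "(s (Suc k) n - s (Suc k + q) n / L ^ (2 * q)) * (A / c * \<gamma> n / L)
      = A * real n powr - (\<alpha> + \<epsilon>) * s (Suc k) n
        - A * (s (Suc k + q) n / L ^ (2 * q) * real n powr - (\<alpha> + \<epsilon>))"
      unfolding gA by (simp add: algebra_simps)
    finally have drift: "A * real n powr - (\<alpha> + \<epsilon>) * s (Suc k) n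
        - A * (s (Suc k + q) n / L ^ (2 * q) * real n powr - (\<alpha> + \<epsilon>))
        \<le> 2 * Suc k * \<kappa> * \<gamma> n * t (Suc k) n" .
    have "s (Suc k + q) n / L ^ (2 * q) * real n powr - (\<alpha> + \<epsilon>)
        \<le> K2 * real n powr - \<tau> / L ^ (2 * q) * real n powr - (\<alpha> + \<epsilon>)"
      using K2(2)[OF n] L by (intro mult_right_mono divide_right_mono) auto
    also have "\<dots> = K2 * real n powr (- \<tau> - 2 * real q * \<epsilon> - (\<alpha> + \<epsilon>))"
      using n unfolding L2q by (simp add: powr_diff powr_minus_divide powr_add field_simps)
    also have "\<dots> \<le> K2 * w" using K2 \<eta>1 by (intro mult_left_mono mono) auto
    finally have 1: "A * (s (Suc k + q) n / L ^ (2 * q) * real n powr - (\<alpha> + \<epsilon>)) \<le> A * (K2 * w)"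
      using A by (intro mult_left_mono) auto
    have "(\<gamma> n)\<^sup>2 * s k n \<le> (\<gamma> n)\<^sup>2 * (K1 * real n powr - \<sigma>)"
      using K1(2)[OF n] by (intro mult_left_mono) auto
    also have "\<dots> = c\<^sup>2 * (K1 * real n powr (- (2 * \<alpha>) - \<sigma>))"
      using n by (simp add: \<gamma>_power powr_diff powr_minus_divide)
    also have "\<dots> \<le> c\<^sup>2 * (K1 * w)" using \<eta>2 K1 by (intro mult_left_mono mono) auto
    finally have 2: "(\<gamma> n)\<^sup>2 * s k n \<le> c\<^sup>2 * (K1 * w)" .
    have "(\<gamma> n)\<^sup>2 * \<gamma> n ^ (2 * k) = c\<^sup>2 * (c ^ (2 * k) * real n powr (- (2 * \<alpha>) - 2 * real k * \<alpha>))"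
      using n by (simp add: \<gamma>_power powr_diff powr_minus_divide)
    also have "\<dots> \<le> c\<^sup>2 * (c ^ (2 * k) * w)"
      using \<eta>3 c by (intro mult_left_mono mono) (auto simp: algebra_simps)
    finally have 3: "(\<gamma> n)\<^sup>2 * \<gamma> n ^ (2 * k) \<le> c\<^sup>2 * (c ^ (2 * k) * w)" .
    have 4: "C k * ((\<gamma> n)\<^sup>2 * s k n + (\<gamma> n)\<^sup>2 * \<gamma> n ^ (2 * k)) \<le> C k * (c\<^sup>2 * (K1 * w) + c\<^sup>2 * (c ^ (2 * k) * w))"
      using 2 3 C_nonneg by (intro mult_left_mono add_mono) auto
    have w: "A * K2 * w \<ge> 0" using A K2 by (simp add: w_def)
    show "s (Suc k) (n + 1) \<le> (1 - A * real n powr - (\<alpha> + \<epsilon>)) * s (Suc k) n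
        + b * real n powr (- (\<alpha> + \<epsilon>) - \<eta>)"
      using recursion[OF n, of k] drift 1 4 w
      unfolding w_def[symmetric] b_def by (simp add: algebra_simps)
  qed (use s_nonneg A b assms \<alpha> in auto)
qed

text \<open>
With \<open>\<epsilon> = (1 - \<alpha>) / 2\<close>, halfway to the critical contraction exponent \<open>1\<close>, each pass gains
\<open>\<alpha> - \<epsilon> = (3 * \<alpha> - 1) / 2 > 0\<close>; boundedness of a sufficiently high moment controls the truncation
error. The rate is not sharp, but it grows without bound in \<open>p\<close>.
\<close>

lemma preliminary_rate:
  "\<exists>K\<ge>0. \<forall>n\<ge>1. s p n \<le> K * real n powr - (p * ((3 * \<alpha> - 1) / 2))"
proof (induction p)
  case 0
  then show ?case using s_0 by (intro exI[of _ 1]) auto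
next
  case (Suc k)
  define \<epsilon> where "\<epsilon> = (1 - \<alpha>) / 2"
  define \<delta> where "\<delta> = (3 * \<alpha> - 1) / 2"
  have \<epsilon>: "0 < \<epsilon>" "\<alpha> + \<epsilon> < 1" "\<delta> = \<alpha> - \<epsilon>" "0 < \<delta>"
    using \<alpha> by (auto simp: \<epsilon>_def \<delta>_def field_simps)
  obtain q :: nat where q: "Suc k * \<delta> / (2 * \<epsilon>) \<le> q" using real_arch_simple by blast
  show ?case unfolding \<delta>_def[symmetric]
  proof (rule rate_step[where \<epsilon> = \<epsilon> and \<tau> = 0 and \<sigma> = "k * \<delta>" and q = q])
    show "\<exists>K\<ge>0. \<forall>n\<ge>1. s k n \<le> K * real n powr - (k * \<delta>)" using Suc by (simp add: \<delta>_def)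
    obtain K where "\<And>n. n \<ge> 1 \<Longrightarrow> s (Suc k + q) n \<le> K" using moments_bounded by blast
    then show "\<exists>K\<ge>0. \<forall>n\<ge>1. s (Suc k + q) n \<le> K * real n powr - 0"
      by (intro exI[of _ "\<bar>K\<bar>"]) (auto intro: order.trans[OF _ abs_ge_self])
    show "Suc k * \<delta> \<le> 0 + 2 * real q * \<epsilon>"
      using q \<epsilon>(1) by (simp add: pos_divide_le_eq mult_ac)
    show "Suc k * \<delta> \<le> k * \<delta> + \<alpha> - \<epsilon>" using \<epsilon> by (simp add: algebra_simps)
    have "0 \<le> k * (\<alpha> + \<epsilon>)" using \<epsilon> \<alpha> by simp
    also have "\<dots> = (2 * real k + 1) * \<alpha> - \<epsilon> - Suc k * \<delta>"
      unfolding \<epsilon>(3) by (simp add: algebra_simps)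
    finally show "Suc k * \<delta> \<le> (2 * real k + 1) * \<alpha> - \<epsilon>" by simp
  qed (use \<epsilon> in auto)
qed

text \<open>
Now even the truncation at the constant level \<open>1\<close> (\<open>\<epsilon> = 0\<close>) is affordable: by the preliminary rate
the higher moment replacing the tail decays faster than the target, if its order is high enough.
\<close>

lemma sharp_rate: "\<exists>K\<ge>0. \<forall>n\<ge>1. s p n \<le> K * real n powr - (p * \<alpha>)"
proof (induction p)
  case 0
  then show ?case using s_0 by (intro exI[of _ 1]) auto
next
  case (Suc k)
  define \<delta> where "\<delta> = (3 * \<alpha> - 1) / 2"
  have \<delta>: "0 < \<delta>" using \<alpha> by (simp add: \<delta>_def)
  obtain q :: nat where q: "Suc k * \<alpha> / \<delta> \<le> q" using real_arch_simple by blast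
  show ?case
  proof (rule rate_step[where \<epsilon> = 0 and \<tau> = "(Suc k + q) * \<delta>" and \<sigma> = "k * \<alpha>" and q = q, OF _ _ _ Suc])
    show "\<exists>K\<ge>0. \<forall>n\<ge>1. s (Suc k + q) n \<le> K * real n powr - ((Suc k + q) * \<delta>)"
      using preliminary_rate[of "Suc k + q"] by (simp add: \<delta>_def)
    have "Suc k * \<alpha> \<le> q * \<delta>" using q \<delta> by (simp add: field_simps)
    also have "\<dots> \<le> (Suc k + q) * \<delta>" using \<delta> by (intro mult_right_mono) auto
    finally show "Suc k * \<alpha> \<le> (Suc k + q) * \<delta> + 2 * real q * 0" by simp
  qed (use \<alpha> in \<open>auto simp: algebra_simps\<close>)
qed

end

lemma powr_bound_imp_bigo:
  fixes x :: "nat \<Rightarrow> real"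
  assumes bound: "\<exists>K\<ge>0. \<forall>n\<ge>1. x n \<le> K * real n powr - \<eta>" and nonneg: "\<And>n. 0 \<le> x n" and le: "\<beta> \<le> \<eta>"
  shows "x \<in> O(\<lambda>n. 1 / real n powr \<beta>)"
proof -
  obtain K where K: "0 \<le> K" "\<And>n. n \<ge> 1 \<Longrightarrow> x n \<le> K * real n powr - \<eta>" using bound by blast
  show ?thesis
  proof (rule bigoI[of _ K])
    show "eventually (\<lambda>n. norm (x n) \<le> K * norm (1 / real n powr \<beta>)) sequentially"
      using eventually_ge_at_top[of 1]
    proof eventually_elim
      case (elim n)
      have "x n \<le> K * real n powr - \<eta>" using K(2) elim by blast
      also have "\<dots> \<le> K * real n powr - \<beta>" using K(1) le elim by (intro mult_left_mono powr_mono) auto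
      finally show ?case using nonneg[of n] by (simp add: powr_minus_divide)
    qed
  qed
qed

section \<open>Convergence rates of the stochastic gradient algorithm\<close>

theorem theorem3p1:
  fixes M :: "'a measure"
    and X :: "'a \<Rightarrow> 'h::{real_inner, complete_space, second_countable_topology}"
    and Xs Z :: "nat \<Rightarrow> 'a \<Rightarrow> 'h"
    and m :: 'h
    and C c \<alpha> \<beta> :: real
    and \<gamma> :: "nat \<Rightarrow> real"
  assumes "prob_space M"
    and X: "X \<in> borel_measurable M"
    and indep: "prob_space.indep_vars M (\<lambda>_. borel) Xs {1..}"
    and copies: "\<And>n. n \<ge> 1 \<Longrightarrow> distr M borel (Xs n) = distr M borel X"
    and cond_i: "\<And>h. \<exists>h'. inner h h' = 0 \<and> evariance M (\<lambda>\<omega>. inner h' (X \<omega>)) > 0"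
    and "C > 0"
    and cond_ii: "\<And>h. inverse_moment 1 M X h \<le> ennreal C \<and> inverse_moment 2 M X h \<le> ennreal C"
    and median: "is_geometric_median M X m"
    and "1 / 2 < \<alpha>" "\<alpha> < 1" "c > 0"
    and \<gamma>: "\<And>n. n \<ge> 1 \<Longrightarrow> \<gamma> n = c * real n powr (- \<alpha>)"
    and Z1_meas: "Z 1 \<in> borel_measurable (vimage_algebra (space M) (Xs 1) borel)"
    and Z1_bounded: "\<exists>B. AE \<omega> in M. norm (Z 1 \<omega>) \<le> B"
    and Z_meas: "\<And>n. n \<ge> 1 \<Longrightarrow> Z n \<in> borel_measurable M"
    and Z_rec: "\<And>n. n \<ge> 1 \<Longrightarrow> AE \<omega> in M.
      Z (n + 1) \<omega> = Z n \<omega> + \<gamma> n *\<^sub>R ((Xs (n + 1) \<omega> - Z n \<omega>) /\<^sub>R norm (Xs (n + 1) \<omega> - Z n \<omega>))"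
    and "\<alpha> < \<beta>" "\<beta> < 3 * \<alpha> - 1"
  shows "(\<forall>n\<ge>1. integrable M (\<lambda>\<omega>. norm (Z n \<omega> - m) ^ 2) \<and> integrable M (\<lambda>\<omega>. norm (Z n \<omega> - m) ^ 4))
    \<and> (\<lambda>n. \<integral>\<omega>. norm (Z n \<omega> - m) ^ 2 \<partial>M) \<in> O(\<lambda>n. 1 / real n powr \<alpha>)
    \<and> (\<lambda>n. \<integral>\<omega>. norm (Z n \<omega> - m) ^ 4 \<partial>M) \<in> O(\<lambda>n. 1 / real n powr \<beta>)"
proof -
  interpret prob_space M by fact
  have Xs [measurable]: "Xs n \<in> borel_measurable M" if "n \<ge> 1" for n
    using indep that unfolding indep_vars_def2 by simp
  have rec: "AE \<omega> in M. Z (n + 1) \<omega> = Z n \<omega> + \<gamma> n *\<^sub>R sgn (Xs (n + 1) \<omega> - Z n \<omega>)" if "n \<ge> 1" for n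
    using Z_rec[OF that] by (simp only: sgn_div_norm)
  have bounded: "\<exists>B. AE \<omega> in M. norm (Z n \<omega> - m) \<le> B" if "n \<ge> 1" for n
    by (rule AE_iterate_bounded[OF Z1_bounded rec that])
  have int: "integrable M (\<lambda>\<omega>. norm (Z n \<omega> - m) ^ p)" if n: "n \<ge> 1" for n p
  proof -
    obtain B where "AE \<omega> in M. norm (Z n \<omega> - m) \<le> B" using bounded[OF n] by blast
    then show ?thesis by (rule integrable_norm_power[OF Z_meas[OF n]])
  qed
  have law: "distr M (borel \<Otimes>\<^sub>M borel) (\<lambda>\<omega>. (Z n \<omega>, Xs (n + 1) \<omega>)) = distr M borel (Z n) \<Otimes>\<^sub>M distr M borel X"
    if n: "n \<ge> 1" for n
  proof -
    have [measurable]: "Z n \<in> borel_measurable M" "Xs (n + 1) \<in> borel_measurable M"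
      using Z_meas[OF n] Xs[of "n + 1"] by auto
    obtain Z' where Z': "Z' \<in> borel_measurable (history M Xs n)" "AE \<omega> in M. Z n \<omega> = Z' \<omega>"
      using adapted_version[OF Z1_meas rec n] by blast
    have [measurable]: "Z' \<in> borel_measurable M"
      by (rule measurable_history_imp_measurable[OF Z'(1)]) (use Xs in auto)
    have "distr M (borel \<Otimes>\<^sub>M borel) (\<lambda>\<omega>. (Z n \<omega>, Xs (n + 1) \<omega>))
      = distr M (borel \<Otimes>\<^sub>M borel) (\<lambda>\<omega>. (Z' \<omega>, Xs (n + 1) \<omega>))"
      using Z'(2) by (intro distr_cong_AE) (auto elim: eventually_mono)
    also have "\<dots> = distr M borel Z' \<Otimes>\<^sub>M distr M borel (Xs (n + 1))"
      by (rule law_of_iterate_and_next_sample[OF indep Z'(1)]) simp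
    also have "distr M borel Z' = distr M borel (Z n)"
      using Z'(2) by (intro distr_cong_AE) (auto elim: eventually_mono)
    also have "distr M borel (Xs (n + 1)) = distr M borel X" by (rule copies) simp
    finally show ?thesis .
  qed
  obtain \<kappa> where \<kappa>: "\<kappa> > 0"
    and drift: "\<And>h. expectation (\<lambda>\<omega>. inner (sgn (X \<omega> - h)) (h - m)) \<le> - \<kappa> * ((norm (h - m))\<^sup>2 / (1 + norm (h - m)))"
    using drift_towards_median[OF X cond_i median] by blast
  define s where "s = (\<lambda>p n. expectation (\<lambda>\<omega>. norm (Z n \<omega> - m) ^ (2 * p)))"
  define t where "t = (\<lambda>p n. expectation (\<lambda>\<omega>. norm (Z n \<omega> - m) ^ (2 * p) / (1 + norm (Z n \<omega> - m))))"
  interpret R: moment_recursion s t \<kappa> c \<alpha> step_const \<gamma>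
  proof
    show "0 \<le> s p n" "0 \<le> t p n" for p n
      by (auto simp: s_def t_def intro!: integral_nonneg_AE)
    show "0 \<le> step_const k" for k by (simp add: step_const_def)
    show "s 0 n \<le> 1" for n by (simp add: s_def prob_space)
    show "s p n - s (p + q) n / L ^ (2 * q) \<le> (1 + L) * t p n" if n: "n \<ge> 1" and L: "L \<ge> 1" for p q n L
    proof -
      obtain B where "AE \<omega> in M. norm (Z n \<omega> - m) \<le> B" using bounded[OF n] by blast
      then have intd: "integrable M (\<lambda>\<omega>. norm (Z n \<omega> - m) ^ (2 * p) / (1 + norm (Z n \<omega> - m)))"
        by (rule integrable_damped_norm_power[OF Z_meas[OF n]])
      have "s p n - s (p + q) n / L ^ (2 * q)
        = expectation (\<lambda>\<omega>. norm (Z n \<omega> - m) ^ (2 * p) - norm (Z n \<omega> - m) ^ (2 * (p + q)) / L ^ (2 * q))"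
        unfolding s_def using int[OF n] by (subst Bochner_Integration.integral_diff) auto
      also have "\<dots> \<le> expectation (\<lambda>\<omega>. (1 + L) * (norm (Z n \<omega> - m) ^ (2 * p) / (1 + norm (Z n \<omega> - m))))"
        using truncated_drift[OF norm_ge_zero L] int[OF n] intd
        by (intro integral_mono Bochner_Integration.integrable_diff integrable_divide integrable_mult_right) auto
      also have "\<dots> = (1 + L) * t p n" unfolding t_def by (rule integral_mult_right_zero)
      finally show ?thesis .
    qed
    show "s (Suc k) (n + 1) \<le> s (Suc k) n - 2 * Suc k * \<kappa> * \<gamma> n * t (Suc k) n
      + step_const k * (\<gamma> n)\<^sup>2 * (s k n + \<gamma> n ^ (2 * k))" if n: "n \<ge> 1" for k n
    proof -
      obtain B where B: "AE \<omega> in M. norm (Z n \<omega> - m) \<le> B" using bounded[OF n] by blast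
      have "0 < \<gamma> n" using n \<open>c > 0\<close> by (simp add: \<gamma>)
      then show ?thesis
        unfolding s_def t_def
        using iterate_moment_step[OF law[OF n] Z_meas[OF n] Z_meas Xs X rec[OF n] B _ drift] n by simp
    qed
  qed (use assms \<kappa> in auto)
  have s2: "(\<lambda>n. expectation (\<lambda>\<omega>. norm (Z n \<omega> - m) ^ 2)) = s 1"
    and s4: "(\<lambda>n. expectation (\<lambda>\<omega>. norm (Z n \<omega> - m) ^ 4)) = s 2"
    by (simp_all add: s_def)
  have "s 1 \<in> O(\<lambda>n. 1 / real n powr \<alpha>)"
    by (rule powr_bound_imp_bigo[OF R.sharp_rate R.s_nonneg]) simp
  moreover have "s 2 \<in> O(\<lambda>n. 1 / real n powr \<beta>)"
    by (rule powr_bound_imp_bigo[OF R.sharp_rate R.s_nonneg]) (use assms in simp)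
  ultimately show ?thesis unfolding s2 s4 using int by blast
qed

end
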